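(* Let $n,d$ be positive integers with $2d<n<3d$, let $X=\binom{[n]}{d}$, and fix $x\in X$. Let $\mathcal{T}$ be the Terwilliger algebra of the Johnson scheme $J(n,d)$ with respect to $x$, and let $\mathcal{M}^{(n,d)}=\bigoplus_{i,j=0}^{d}L(M^{(n,d)}_{i,j})\subseteq \mathrm{Mat}_X(\mathbb{C})$. Then $\mathcal{T}=\mathcal{M}^{(n,d)}$.
   Context: Johnson scheme and Terwilliger algebra. $[n]=\{1,\dots,n\}$ and $\binom{[n]}{d}$ is the set of $d$-subsets of $[n]$. $\mathrm{Mat}_X(\mathbb{C})$ is the algebra of complex matrices with rows and columns indexed by $X=\binom{[n]}{d}$. For $0\le i\le d$ let $R_i=\{(y,z)\in X\times X: |y\cap z|=d-i\}$ and let $A_i\in\mathrm{Mat}_X(\mathbb{C})$ be the $0/1$ matrix with $(y,z)$-entry $1$ iff $(y,z)\in R_i$; $J(n,d)=(X,\{R_i\}_{i=0}^d)$. For fixed $x\in X$ let $E_i^*$ be the diagonal matrix with $(y,y)$-entry $1$ if $(x,y)\in R_i$ and $0$ otherwise. The Terwilliger algebra $\mathcal{T}$ (with respect to $x$) is the subalgebra of $\mathrm{Mat}_X(\mathbb{C})$ generated by $A_0,\dots,A_d,E_0^*,\dots,E_d^*$. Intersection matrices. $H^r_{i,j}(v)$ is the $0/1$ matrix with rows indexed by $\binom{[v]}{i}$ and columns by $\binom{[v]}{j}$ whose $(\alpha,\beta)$-entry is $1$ iff $|\alpha\cap\beta|=r$; $H_{i,j}(v):=H^{\min(i,j)}_{i,j}(v)$.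 For $0\le k\le v$, $\mathcal{B}^{(v,k)}$ is the Bose–Mesner algebra of $J(v,k)$, i.e. the complex span of the matrices $H^r_{k,k}(v)$, $0\le r\le k$. Block structure. Let $\Omega_i=\{y\in X: |x\cap y|=d-i\}$, so $X=\dot\cup_{i=0}^d\Omega_i$. Fixing bijections $x\leftrightarrow[d]$ and $[n]\setminus x\leftrightarrow[n-d]$, identify $y\in\Omega_i$ with the pair $(y\cap x,\,y\setminus x)\in\binom{[d]}{d-i}\times\binom{[n-d]}{i}$; thus matrices with rows indexed by $\Omega_i$ and columns by $\Omega_j$ include Kronecker products $B\otimes C$ with $B$ indexed by $\binom{[d]}{d-i}\times\binom{[d]}{d-j}$ and $C$ by $\binom{[n-d]}{i}\times\binom{[n-d]}{j}$. For $0\le i,j\le d$ put $$M^{(n,d)}_{i,j}=(\mathcal{B}^{(d,d-i)}H_{d-i,d-j}(d))\otimes(\mathcal{B}^{(n-d,i)}H_{i,j}(n-d)).$$ For $Y\in M^{(n,d)}_{i,j}$, $L(Y)\in\mathrm{Mat}_X(\mathbb{C})$ is the matrix whose $\Omega_i\times\Omega_j$ block is $Y$ and whose other blocks are $0$. *)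

theory Defs
  imports Complex_Main "HOL-Library.Function_Algebras" "HOL-Library.Ramsey"
begin

text \<open>
  Complex matrices whose rows and columns are indexed by arbitrary finite sets \<open>R\<close>, \<open>C\<close> are
  represented by functions vanishing outside \<open>R \<times> C\<close>. Addition and zero are the pointwise ones
  of \<^theory>\<open>HOL-Library.Function_Algebras\<close> (whose \<open>*\<close> and \<open>1\<close> on functions are pointwise as well
  and are not used). The set of \<open>k\<close>-subsets of \<open>{1..v}\<close> is written \<open>[{1..v}]\<^bsup>k\<^esup>\<close>, see
  \<^const>\<open>nsets\<close>.
\<close>

type_synonym ('r, 'c) cmatrix = "'r \<Rightarrow> 'c \<Rightarrow> complex"

definition cmatrices :: "'r set \<Rightarrow> 'c set \<Rightarrow> ('r, 'c) cmatrix set" where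
  "cmatrices R C = {A. \<forall>r c. A r c \<noteq> 0 \<longrightarrow> r \<in> R \<and> c \<in> C}"

definition cmat_scale :: "complex \<Rightarrow> ('r, 'c) cmatrix \<Rightarrow> ('r, 'c) cmatrix" where
  "cmat_scale c A = (\<lambda>r s. c * A r s)"

global_interpretation cmat: vector_space cmat_scale
  by unfold_locales (auto simp: cmat_scale_def fun_eq_iff algebra_simps)

definition cmat_mult ::
    "'k set \<Rightarrow> ('r, 'k) cmatrix \<Rightarrow> ('k, 'c) cmatrix \<Rightarrow> ('r, 'c) cmatrix" where
  "cmat_mult K A B = (\<lambda>r c. \<Sum>k\<in>K. A r k * B k c)"

definition cmat_one :: "'r set \<Rightarrow> ('r, 'r) cmatrix" where
  "cmat_one R = (\<lambda>r s. of_bool (r \<in> R \<and> r = s))"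

definition kronecker ::
    "('r, 'c) cmatrix \<Rightarrow> ('s, 'e) cmatrix \<Rightarrow> ('r \<times> 's, 'c \<times> 'e) cmatrix" where
  "kronecker B C = (\<lambda>(r, s) (c, e). B r c * C s e)"

definition matrix_subalgebra :: "'r set \<Rightarrow> ('r, 'r) cmatrix set \<Rightarrow> bool" where
  "matrix_subalgebra R S \<longleftrightarrow>
     S \<subseteq> cmatrices R R \<and> cmat.subspace S \<and> cmat_one R \<in> S \<and>
     (\<forall>A\<in>S. \<forall>B\<in>S. cmat_mult R A B \<in> S)"


section \<open>The Johnson scheme and its Terwilliger algebra\<close>

definition johnson_rel :: "nat \<Rightarrow> nat \<Rightarrow> nat \<Rightarrow> (nat set \<times> nat set) set" where
  "johnson_rel n d i =
     {(y, z). y \<in> [{1..n}]\<^bsup>d\<^esup> \<and> z \<in> [{1..n}]\<^bsup>d\<^esup> \<and> card (y \<inter> z) = d - i}"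

definition johnson_adj :: "nat \<Rightarrow> nat \<Rightarrow> nat \<Rightarrow> (nat set, nat set) cmatrix" where
  "johnson_adj n d i = (\<lambda>y z. of_bool ((y, z) \<in> johnson_rel n d i))"

definition dual_idempotent ::
    "nat \<Rightarrow> nat \<Rightarrow> nat set \<Rightarrow> nat \<Rightarrow> (nat set, nat set) cmatrix" where
  "dual_idempotent n d x i = (\<lambda>y z. of_bool (y = z \<and> (x, y) \<in> johnson_rel n d i))"

definition terwilliger_algebra ::
    "nat \<Rightarrow> nat \<Rightarrow> nat set \<Rightarrow> (nat set, nat set) cmatrix set" where
  "terwilliger_algebra n d x =
     matrix_subalgebra ([{1..n}]\<^bsup>d\<^esup>) hull
       (johnson_adj n d ` {0..d} \<union> dual_idempotent n d x ` {0..d})"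


section \<open>Intersection matrices\<close>

definition intersection_matrix ::
    "nat \<Rightarrow> nat \<Rightarrow> nat \<Rightarrow> nat \<Rightarrow> (nat set, nat set) cmatrix" where
  "intersection_matrix r i j v = (\<lambda>\<alpha> \<beta>.
     of_bool (\<alpha> \<in> [{1..v}]\<^bsup>i\<^esup> \<and> \<beta> \<in> [{1..v}]\<^bsup>j\<^esup> \<and> card (\<alpha> \<inter> \<beta>) = r))"

abbreviation inclusion_matrix :: "nat \<Rightarrow> nat \<Rightarrow> nat \<Rightarrow> (nat set, nat set) cmatrix" where
  "inclusion_matrix i j v \<equiv> intersection_matrix (min i j) i j v"

definition bose_mesner :: "nat \<Rightarrow> nat \<Rightarrow> (nat set, nat set) cmatrix set" where
  "bose_mesner v k = cmat.span ((\<lambda>r. intersection_matrix r k k v) ` {0..k})"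

text \<open>The space \<open>\<B>\<^bsup>(v,i)\<^esup> H\<^bsub>i,j\<^esub>(v)\<close>.\<close>

definition bose_mesner_inclusion ::
    "nat \<Rightarrow> nat \<Rightarrow> nat \<Rightarrow> (nat set, nat set) cmatrix set" where
  "bose_mesner_inclusion v i j =
     (\<lambda>B. cmat_mult ([{1..v}]\<^bsup>i\<^esup>) B (inclusion_matrix i j v)) ` bose_mesner v i"


section \<open>The block space\<close>

text \<open>The tensor product of two matrix spaces is the span of the Kronecker products.\<close>

definition block_space ::
    "nat \<Rightarrow> nat \<Rightarrow> nat \<Rightarrow> nat \<Rightarrow> (nat set \<times> nat set, nat set \<times> nat set) cmatrix set" where
  "block_space n d i j =
     cmat.span {kronecker P Q | P Q.
       P \<in> bose_mesner_inclusion d (d - i) (d - j) \<and> Q \<in> bose_mesner_inclusion (n - d) i j}"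

definition sphere_at :: "nat \<Rightarrow> nat \<Rightarrow> nat set \<Rightarrow> nat \<Rightarrow> nat set set" where
  "sphere_at n d x i = {y \<in> [{1..n}]\<^bsup>d\<^esup>. card (x \<inter> y) = d - i}"

text \<open>
  The maps \<open>f\<close> and \<open>g\<close> are meant to be bijections from \<open>x\<close> onto \<open>{1..d}\<close> and from \<open>{1..n} - x\<close>
  onto \<open>{1..n - d}\<close>.
\<close>

definition split_at ::
    "nat set \<Rightarrow> (nat \<Rightarrow> nat) \<Rightarrow> (nat \<Rightarrow> nat) \<Rightarrow> nat set \<Rightarrow> nat set \<times> nat set" where
  "split_at x f g y = (f ` (y \<inter> x), g ` (y - x))"

definition block_embedding ::
    "nat \<Rightarrow> nat \<Rightarrow> nat set \<Rightarrow> (nat \<Rightarrow> nat) \<Rightarrow> (nat \<Rightarrow> nat) \<Rightarrow> nat \<Rightarrow> nat \<Rightarrow>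
     (nat set \<times> nat set, nat set \<times> nat set) cmatrix \<Rightarrow> (nat set, nat set) cmatrix" where
  "block_embedding n d x f g i j Y = (\<lambda>y z.
     if y \<in> sphere_at n d x i \<and> z \<in> sphere_at n d x j
     then Y (split_at x f g y) (split_at x f g z) else 0)"

text \<open>
  The sum of the embedded block spaces. It is direct, as shown in the lemma that follows.
\<close>

definition block_sum ::
    "nat \<Rightarrow> nat \<Rightarrow> nat set \<Rightarrow> (nat \<Rightarrow> nat) \<Rightarrow> (nat \<Rightarrow> nat) \<Rightarrow> (nat set, nat set) cmatrix set" where
  "block_sum n d x f g =
     {(\<Sum>i\<in>{0..d}. \<Sum>j\<in>{0..d}. block_embedding n d x f g i j (Y i j)) | Y.
        \<forall>i\<in>{0..d}. \<forall>j\<in>{0..d}. Y i j \<in> block_space n d i j}"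

lemma sum_fun2_apply: "sum F I y z = (\<Sum>i\<in>I. F i y z)"
  for F :: "'i \<Rightarrow> ('r, 'c) cmatrix"
  by (induction I rule: infinite_finite_induct) auto

lemma block_sum_entry:
  assumes "i \<le> d" "j \<le> d" "y \<in> sphere_at n d x i" "z \<in> sphere_at n d x j"
  shows "(\<Sum>i\<in>{0..d}. \<Sum>j\<in>{0..d}. block_embedding n d x f g i j (Y i j)) y z =
    block_embedding n d x f g i j (Y i j) y z"
proof -
  have y: "y \<in> sphere_at n d x i' \<longleftrightarrow> i' = i" and z: "z \<in> sphere_at n d x i' \<longleftrightarrow> i' = j"
    if "i' \<in> {0..d}" for i'
    using that assms by (auto simp: sphere_at_def)
  have "(\<Sum>i\<in>{0..d}. \<Sum>j\<in>{0..d}. block_embedding n d x f g i j (Y i j)) y z =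
    (\<Sum>i'\<in>{0..d}. \<Sum>j'\<in>{0..d}. if i' = i then if j' = j
       then block_embedding n d x f g i j (Y i j) y z else 0 else 0)"
    unfolding sum_fun2_apply
    by (intro sum.cong refl) (auto simp: block_embedding_def y z)
  also have "\<dots> = (\<Sum>i'\<in>{0..d}. if i' = i
       then block_embedding n d x f g i j (Y i j) y z else 0)"
    using assms by (intro sum.cong refl) auto
  also have "\<dots> = block_embedding n d x f g i j (Y i j) y z"
    using assms by auto
  finally show ?thesis .
qed

lemma block_sum_direct:
  assumes "(\<Sum>i\<in>{0..d}. \<Sum>j\<in>{0..d}. block_embedding n d x f g i j (Y i j)) =
           (\<Sum>i\<in>{0..d}. \<Sum>j\<in>{0..d}. block_embedding n d x f g i j (Z i j))"
    and "i \<le> d" "j \<le> d"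
  shows "block_embedding n d x f g i j (Y i j) = block_embedding n d x f g i j (Z i j)"
proof (intro ext)
  fix y z
  show "block_embedding n d x f g i j (Y i j) y z = block_embedding n d x f g i j (Z i j) y z"
  proof (cases "y \<in> sphere_at n d x i \<and> z \<in> sphere_at n d x j")
    case True
    with assms show ?thesis
      using block_sum_entry[of i d j y n x z f g Y] block_sum_entry[of i d j y n x z f g Z] by simp
  qed (auto simp: block_embedding_def)
qed

end

theory Submission
  imports Defs "HOL-Combinatorics.Permutations"
begin

text \<open>
  Both algebras turn out to be the space of all matrices that are invariant under the stabilizer of
  \<open>x\<close> in the symmetric group, that is, whose entry at \<open>y \<in> \<Omega>\<^sub>i\<close>, \<open>z \<in> \<Omega>\<^sub>j\<close> depends only on \<open>i\<close>, \<open>j\<close>,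
  \<open>r = |x \<inter> y \<inter> z|\<close> and \<open>s = |(y \<inter> z) - x|\<close>.

  For the block sum, this amounts to showing that \<open>\<B>\<^bsup>(v,i)\<^esup> H\<^bsub>i,j\<^esub>(v)\<close> consists of all matrices whose
  entries depend only on \<open>|\<alpha> \<inter> \<beta>|\<close> (\<open>bose_mesner_inclusion_eq\<close>). For \<open>i \<le> j\<close>, the matrix with entries
  \<open>|\<alpha> \<inter> \<gamma>| choose k\<close> times the inclusion matrix is a nonzero multiple of the matrix with entries
  \<open>|\<alpha> \<inter> \<beta>| choose k\<close>, and binomial coefficients span all functions on an initial segment; taking
  complements gives the case \<open>j < i\<close> (\<open>inclusion_generates\<close>).

  The invariant matrices form an algebra containing the generators of the Terwilliger algebra, hence
  contain it. Conversely, let \<open>T\<close> be an algebra containing the generators. The blocks of the adjacency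
  matrices give the functions of \<open>r + s\<close> only. The extreme value of \<open>r + s\<close> yields the Kronecker
  product of two inclusion matrices (\<open>orbit_inclusion_mem\<close>). On a diagonal block, a linear combination
  of the identity, the distance-one block and the two products of inclusion matrices through the
  neighbouring blocks isolates \<open>A \<otimes> I\<close>, where \<open>A\<close> is the distance-one matrix of the Johnson scheme on
  the subsets of \<open>x\<close>; the coefficient is \<open>n - 2 d\<close>, which is nonzero (\<open>orbit_left_adjacency_mem\<close>).
  Then \<open>T\<close> also contains \<open>I \<otimes> A'\<close>, with \<open>A'\<close> the distance-one matrix for the complement of \<open>x\<close>. Since
  the distance-one matrix generates the Bose-Mesner algebra (\<open>johnson_generated_by_adjacency\<close>), \<open>T\<close>
  contains the full tensor product on each diagonal block, and multiplying by the inclusion matrices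
  and using \<open>inclusion_generates\<close> once more yields every block (\<open>orbit_mem\<close>).
\<close>


section \<open>Counting subsets\<close>

lemma card_subsets_between:
  assumes "finite b" "a \<subseteq> b" "card a \<le> k"
  shows "card {w. a \<subseteq> w \<and> w \<subseteq> b \<and> card w = k} = (card b - card a) choose (k - card a)"
proof -
  have fa: "finite a" using assms finite_subset by blast
  have "bij_betw (\<lambda>w. w - a) {w. a \<subseteq> w \<and> w \<subseteq> b \<and> card w = k}
      {w. w \<subseteq> b - a \<and> card w = k - card a}"
  proof (rule bij_betw_byWitness[where f' = "\<lambda>w. w \<union> a"])
    show "(\<lambda>w. w - a) ` {w. a \<subseteq> w \<and> w \<subseteq> b \<and> card w = k}
        \<subseteq> {w. w \<subseteq> b - a \<and> card w = k - card a}"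
      using fa by (auto simp: card_Diff_subset)
    have "card (w \<union> a) = k" if "w \<subseteq> b - a" "card w = k - card a" for w
    proof -
      have "card (w \<union> a) = card w + card a"
        using that fa assms by (intro card_Un_disjoint) (auto intro: finite_subset)
      then show ?thesis using that assms by simp
    qed
    then show "(\<lambda>w. w \<union> a) ` {w. w \<subseteq> b - a \<and> card w = k - card a}
        \<subseteq> {w. a \<subseteq> w \<and> w \<subseteq> b \<and> card w = k}"
      using assms by auto
  qed auto
  then have "card {w. a \<subseteq> w \<and> w \<subseteq> b \<and> card w = k}
      = card {w. w \<subseteq> b - a \<and> card w = k - card a}"
    by (rule bij_betw_same_card)
  also have "\<dots> = (card b - card a) choose (k - card a)"
    using assms fa by (simp add: n_subsets card_Diff_subset)
  finally show ?thesis .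
qed

lemma nsets_iff_card: "finite V \<Longrightarrow> N \<in> [V]\<^bsup>k\<^esup> \<longleftrightarrow> N \<subseteq> V \<and> card N = k"
  by (auto simp: nsets_def intro: finite_subset)

lemma card_Int_eq_left_iff: "finite a \<Longrightarrow> card (a \<inter> b) = card a \<longleftrightarrow> a \<subseteq> b"
  by (metis Int_lower1 card_subset_eq inf.absorb_iff1)

lemma sum_of_bool_eq_card:
  "finite A \<Longrightarrow> (\<Sum>a\<in>A. of_bool (P a)) = of_nat (card {a\<in>A. P a})"
  by (simp add: sum.If_cases of_bool_def Int_def)

text \<open>The subsets of \<open>\<alpha> \<inter> \<beta>\<close> and the supersets of \<open>\<alpha> \<union> \<beta>\<close> whose size differs by one from that of
  \<open>\<alpha>\<close> and \<open>\<beta>\<close>.\<close>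

lemma sum_common_subsets:
  assumes "finite V" "\<alpha> \<in> [V]\<^bsup>Suc m\<^esup>" "\<beta> \<in> [V]\<^bsup>Suc m\<^esup>"
  shows "(\<Sum>\<gamma>\<in>[V]\<^bsup>m\<^esup>. of_bool (card (\<alpha> \<inter> \<gamma>) = m) * of_bool (card (\<gamma> \<inter> \<beta>) = m))
     = (if card (\<alpha> \<inter> \<beta>) = Suc m then of_nat (Suc m) else of_bool (card (\<alpha> \<inter> \<beta>) = m) :: complex)"
proof -
  have *: "\<alpha> \<subseteq> V" "\<beta> \<subseteq> V" "card \<alpha> = Suc m" "card \<beta> = Suc m"
    using assms by (auto simp: nsets_def)
  have fin: "finite \<alpha>" "finite \<beta>" using * assms(1) finite_subset by auto
  have iff: "card (\<alpha> \<inter> \<gamma>) = m \<and> card (\<gamma> \<inter> \<beta>) = m \<longleftrightarrow> \<gamma> \<subseteq> \<alpha> \<inter> \<beta>" if "\<gamma> \<in> [V]\<^bsup>m\<^esup>" for \<gamma>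
    using that card_Int_eq_left_iff[of \<gamma> \<alpha>] card_Int_eq_left_iff[of \<gamma> \<beta>]
    by (auto simp: nsets_def Int_commute)
  have "(\<Sum>\<gamma>\<in>[V]\<^bsup>m\<^esup>. of_bool (card (\<alpha> \<inter> \<gamma>) = m) * of_bool (card (\<gamma> \<inter> \<beta>) = m) :: complex)
      = (\<Sum>\<gamma>\<in>[V]\<^bsup>m\<^esup>. of_bool (\<gamma> \<subseteq> \<alpha> \<inter> \<beta>))"
    using iff by (intro sum.cong) (auto simp flip: of_bool_conj)
  also have "\<dots> = of_nat (card {\<gamma> \<in> [V]\<^bsup>m\<^esup>. \<gamma> \<subseteq> \<alpha> \<inter> \<beta>})"
    using assms(1) by (intro sum_of_bool_eq_card finite_imp_finite_nsets)
  also have "{\<gamma> \<in> [V]\<^bsup>m\<^esup>. \<gamma> \<subseteq> \<alpha> \<inter> \<beta>} = {\<gamma>. \<gamma> \<subseteq> \<alpha> \<inter> \<beta> \<and> card \<gamma> = m}"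
    using * assms(1) by (auto simp: nsets_iff_card)
  also have "card \<dots> = card (\<alpha> \<inter> \<beta>) choose m"
    using fin by (intro n_subsets) auto
  finally show ?thesis
    using card_mono[of \<alpha> "\<alpha> \<inter> \<beta>"] fin * by (auto simp: le_Suc_eq)
qed

lemma sum_common_supersets:
  assumes "finite V" "\<alpha> \<in> [V]\<^bsup>m\<^esup>" "\<beta> \<in> [V]\<^bsup>m\<^esup>"
  shows "(\<Sum>\<gamma>\<in>[V]\<^bsup>Suc m\<^esup>. of_bool (card (\<alpha> \<inter> \<gamma>) = m) * of_bool (card (\<gamma> \<inter> \<beta>) = m))
     = (if card (\<alpha> \<inter> \<beta>) = m then of_nat (card V - m)
        else of_bool (Suc (card (\<alpha> \<inter> \<beta>)) = m) :: complex)"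
proof -
  have *: "\<alpha> \<subseteq> V" "\<beta> \<subseteq> V" "card \<alpha> = m" "card \<beta> = m"
    using assms by (auto simp: nsets_def)
  have fin: "finite \<alpha>" "finite \<beta>" using * assms(1) finite_subset by auto
  have iff: "card (\<alpha> \<inter> \<gamma>) = m \<and> card (\<gamma> \<inter> \<beta>) = m \<longleftrightarrow> \<alpha> \<union> \<beta> \<subseteq> \<gamma>" if "\<gamma> \<in> [V]\<^bsup>Suc m\<^esup>" for \<gamma>
    using that * fin card_Int_eq_left_iff[of \<alpha> \<gamma>] card_Int_eq_left_iff[of \<beta> \<gamma>]
    by (auto simp: nsets_def Int_commute)
  have un: "card (\<alpha> \<union> \<beta>) + card (\<alpha> \<inter> \<beta>) = 2 * m"
    using card_Un_Int[OF fin] * by simp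
  have int: "card (\<alpha> \<inter> \<beta>) \<le> m" using card_mono[of \<alpha> "\<alpha> \<inter> \<beta>"] fin * by simp
  have "(\<Sum>\<gamma>\<in>[V]\<^bsup>Suc m\<^esup>. of_bool (card (\<alpha> \<inter> \<gamma>) = m) * of_bool (card (\<gamma> \<inter> \<beta>) = m) :: complex)
      = (\<Sum>\<gamma>\<in>[V]\<^bsup>Suc m\<^esup>. of_bool (\<alpha> \<union> \<beta> \<subseteq> \<gamma>))"
    using iff by (intro sum.cong) (auto simp flip: of_bool_conj)
  also have "\<dots> = of_nat (card {\<gamma> \<in> [V]\<^bsup>Suc m\<^esup>. \<alpha> \<union> \<beta> \<subseteq> \<gamma>})"
    using assms(1) by (intro sum_of_bool_eq_card finite_imp_finite_nsets)
  also have "{\<gamma> \<in> [V]\<^bsup>Suc m\<^esup>. \<alpha> \<union> \<beta> \<subseteq> \<gamma>} = {\<gamma>. \<alpha> \<union> \<beta> \<subseteq> \<gamma> \<and> \<gamma> \<subseteq> V \<and> card \<gamma> = Suc m}"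
    using assms(1) by (auto simp: nsets_iff_card)
  also have "card \<dots> = (if card (\<alpha> \<union> \<beta>) \<le> Suc m
      then (card V - card (\<alpha> \<union> \<beta>)) choose (Suc m - card (\<alpha> \<union> \<beta>)) else 0)"
  proof (cases "card (\<alpha> \<union> \<beta>) \<le> Suc m")
    case True
    then show ?thesis
      using card_subsets_between[of V "\<alpha> \<union> \<beta>" "Suc m"] assms(1) * by (simp del: Un_subset_iff)
  next
    case False
    have "card \<gamma> \<noteq> Suc m" if "\<alpha> \<union> \<beta> \<subseteq> \<gamma>" "\<gamma> \<subseteq> V" for \<gamma>
      using card_mono[OF finite_subset[OF that(2) assms(1)] that(1)] False by linarith
    then have "{\<gamma>. \<alpha> \<union> \<beta> \<subseteq> \<gamma> \<and> \<gamma> \<subseteq> V \<and> card \<gamma> = Suc m} = {}"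
      by (intro Collect_empty_eq[THEN iffD2]) iprover
    then show ?thesis using False by (simp only: if_False card.empty)
  qed
  finally have eq: "(\<Sum>\<gamma>\<in>[V]\<^bsup>Suc m\<^esup>. of_bool (card (\<alpha> \<inter> \<gamma>) = m) * of_bool (card (\<gamma> \<inter> \<beta>) = m))
      = (of_nat (if card (\<alpha> \<union> \<beta>) \<le> Suc m
      then (card V - card (\<alpha> \<union> \<beta>)) choose (Suc m - card (\<alpha> \<union> \<beta>)) else 0) :: complex)" .
  show ?thesis
  proof (cases "card (\<alpha> \<inter> \<beta>) = m")
    case True
    then have "card (\<alpha> \<union> \<beta>) = m" using un by simp
    with True show ?thesis by (simp add: eq Suc_diff_le)
  next
    case False
    show ?thesis
    proof (cases "Suc (card (\<alpha> \<inter> \<beta>)) = m")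
      case True
      then have "card (\<alpha> \<union> \<beta>) = Suc m" using un by simp
      with True False show ?thesis by (simp add: eq)
    next
      case F: False
      then have "\<not> card (\<alpha> \<union> \<beta>) \<le> Suc m" using un int False by linarith
      with F False show ?thesis by (simp add: eq)
    qed
  qed
qed


section \<open>Functions of the size of an intersection\<close>

text \<open>The binomial coefficients \<open>r choose k\<close> with \<open>k \<le> N\<close> span the functions
  on \<open>{0..N}\<close>.\<close>

lemma binomial_basis:
  fixes \<psi> :: "nat \<Rightarrow> complex"
  shows "\<exists>c. \<forall>r\<le>N. \<psi> r = (\<Sum>k\<le>N. c k * of_nat (r choose k))"
proof (induction N)
  case 0
  then show ?case by auto
next
  case (Suc N)
  then obtain c where c: "\<And>r. r \<le> N \<Longrightarrow> \<psi> r = (\<Sum>k\<le>N. c k * of_nat (r choose k))" by blast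
  define c' where "c' = c(Suc N := \<psi> (Suc N) - (\<Sum>k\<le>N. c k * of_nat (Suc N choose k)))"
  have eq: "(\<Sum>k\<le>N. c' k * of_nat (r choose k)) = (\<Sum>k\<le>N. c k * of_nat (r choose k))" for r
    by (intro sum.cong) (auto simp: c'_def)
  have "\<psi> r = (\<Sum>k\<le>Suc N. c' k * of_nat (r choose k))" if "r \<le> Suc N" for r
  proof (cases "r = Suc N")
    case True
    then show ?thesis by (simp add: eq) (simp add: c'_def)
  next
    case False
    then show ?thesis using that c[of r] by (simp add: eq)
  qed
  then show ?case by blast
qed

text \<open>The matrix with entries \<open>C(|\<alpha> \<inter> \<gamma>|, k)\<close> counts the \<open>k\<close>-subsets common to \<open>\<alpha>\<close> and \<open>\<gamma>\<close>, so
  its product with the inclusion matrix has entries \<open>C(j - k, i - k) C(|\<alpha> \<inter> \<beta>|, k)\<close>.\<close>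

lemma sum_binomial_inclusion:
  assumes "finite V" "\<alpha> \<in> [V]\<^bsup>i\<^esup>" "\<beta> \<in> [V]\<^bsup>j\<^esup>" "i \<le> j" "k \<le> i"
  shows "(\<Sum>\<gamma>\<in>[V]\<^bsup>i\<^esup>. of_nat (card (\<alpha> \<inter> \<gamma>) choose k) * of_bool (card (\<gamma> \<inter> \<beta>) = i))
     = (of_nat ((j - k) choose (i - k)) * of_nat (card (\<alpha> \<inter> \<beta>) choose k) :: complex)"
proof -
  have *: "\<alpha> \<subseteq> V" "\<beta> \<subseteq> V" "card \<alpha> = i" "card \<beta> = j" "finite \<alpha>" "finite \<beta>"
    using assms by (auto simp: nsets_def)
  have fn: "finite ([V]\<^bsup>i\<^esup>)" "finite ([\<alpha> \<inter> \<beta>]\<^bsup>k\<^esup>)" "finite ([\<alpha>]\<^bsup>k\<^esup>)"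
    using assms(1) * by (auto intro!: finite_imp_finite_nsets)
  have one: "of_nat (card (\<alpha> \<inter> \<gamma>) choose k) = (\<Sum>\<kappa>\<in>[\<alpha>]\<^bsup>k\<^esup>. of_bool (\<kappa> \<subseteq> \<gamma>) :: complex)" for \<gamma>
  proof -
    have "{\<kappa> \<in> [\<alpha>]\<^bsup>k\<^esup>. \<kappa> \<subseteq> \<gamma>} = {\<kappa>. \<kappa> \<subseteq> \<alpha> \<inter> \<gamma> \<and> card \<kappa> = k}"
      using * by (auto simp: nsets_iff_card)
    moreover have "card {\<kappa>. \<kappa> \<subseteq> \<alpha> \<inter> \<gamma> \<and> card \<kappa> = k} = card (\<alpha> \<inter> \<gamma>) choose k"
      using * by (intro n_subsets) auto
    ultimately show ?thesis using fn by (simp only: sum_of_bool_eq_card)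
  qed
  have inner: "(\<Sum>\<gamma>\<in>[V]\<^bsup>i\<^esup>. of_bool (\<kappa> \<subseteq> \<gamma> \<and> card (\<gamma> \<inter> \<beta>) = i))
      = (of_bool (\<kappa> \<subseteq> \<beta>) * of_nat ((j - k) choose (i - k)) :: complex)"
    if "\<kappa> \<in> [\<alpha>]\<^bsup>k\<^esup>" for \<kappa>
  proof -
    have k: "card \<kappa> = k" using that by (auto simp: nsets_def)
    have "{\<gamma> \<in> [V]\<^bsup>i\<^esup>. \<kappa> \<subseteq> \<gamma> \<and> card (\<gamma> \<inter> \<beta>) = i} = {\<gamma>. \<kappa> \<subseteq> \<gamma> \<and> \<gamma> \<subseteq> \<beta> \<and> card \<gamma> = i}"
    proof (rule set_eqI)
      fix \<gamma>
      have "card (\<gamma> \<inter> \<beta>) = i \<longleftrightarrow> \<gamma> \<subseteq> \<beta>" if "\<gamma> \<in> [V]\<^bsup>i\<^esup>"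
        using that card_Int_eq_left_iff[of \<gamma> \<beta>] by (auto simp: nsets_def)
      then show "\<gamma> \<in> {\<gamma> \<in> [V]\<^bsup>i\<^esup>. \<kappa> \<subseteq> \<gamma> \<and> card (\<gamma> \<inter> \<beta>) = i} \<longleftrightarrow>
          \<gamma> \<in> {\<gamma>. \<kappa> \<subseteq> \<gamma> \<and> \<gamma> \<subseteq> \<beta> \<and> card \<gamma> = i}"
        using * assms(1) by (auto simp: nsets_iff_card)
    qed
    moreover have "card {\<gamma>. \<kappa> \<subseteq> \<gamma> \<and> \<gamma> \<subseteq> \<beta> \<and> card \<gamma> = i} = (j - k) choose (i - k)" if "\<kappa> \<subseteq> \<beta>"
      using card_subsets_between[of \<beta> \<kappa> i] that * k assms by simp
    moreover have "{\<gamma>. \<kappa> \<subseteq> \<gamma> \<and> \<gamma> \<subseteq> \<beta> \<and> card \<gamma> = i} = {}" if "\<not> \<kappa> \<subseteq> \<beta>"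
      using that by auto
    ultimately have "card {\<gamma> \<in> [V]\<^bsup>i\<^esup>. \<kappa> \<subseteq> \<gamma> \<and> card (\<gamma> \<inter> \<beta>) = i}
        = of_bool (\<kappa> \<subseteq> \<beta>) * ((j - k) choose (i - k))"
      by (cases "\<kappa> \<subseteq> \<beta>") (simp_all only: card.empty if_True of_bool_eq mult_zero_left mult_1
          simp_thms)
    then show ?thesis by (simp only: sum_of_bool_eq_card[OF fn(1)] of_nat_mult of_nat_of_bool)
  qed
  have "(\<Sum>\<gamma>\<in>[V]\<^bsup>i\<^esup>. of_nat (card (\<alpha> \<inter> \<gamma>) choose k) * of_bool (card (\<gamma> \<inter> \<beta>) = i) :: complex)
      = (\<Sum>\<gamma>\<in>[V]\<^bsup>i\<^esup>. \<Sum>\<kappa>\<in>[\<alpha>]\<^bsup>k\<^esup>. of_bool (\<kappa> \<subseteq> \<gamma> \<and> card (\<gamma> \<inter> \<beta>) = i))"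
    by (simp add: one sum_distrib_right of_bool_conj)
  also have "\<dots> = (\<Sum>\<kappa>\<in>[\<alpha>]\<^bsup>k\<^esup>. \<Sum>\<gamma>\<in>[V]\<^bsup>i\<^esup>. of_bool (\<kappa> \<subseteq> \<gamma> \<and> card (\<gamma> \<inter> \<beta>) = i))"
    by (rule sum.swap)
  also have "\<dots> = (\<Sum>\<kappa>\<in>[\<alpha>]\<^bsup>k\<^esup>. of_bool (\<kappa> \<subseteq> \<beta>)) * of_nat ((j - k) choose (i - k))"
    by (simp add: inner sum_distrib_right)
  finally show ?thesis by (simp add: one mult.commute)
qed

lemma inclusion_generates_le:
  fixes \<psi> :: "nat \<Rightarrow> complex"
  assumes "finite V" "i \<le> j"
  shows "\<exists>\<phi>. \<forall>\<alpha>\<in>[V]\<^bsup>i\<^esup>. \<forall>\<beta>\<in>[V]\<^bsup>j\<^esup>.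
    (\<Sum>\<gamma>\<in>[V]\<^bsup>i\<^esup>. \<phi> (card (\<alpha> \<inter> \<gamma>)) * of_bool (card (\<gamma> \<inter> \<beta>) = i)) = \<psi> (card (\<alpha> \<inter> \<beta>))"
proof -
  obtain c where c: "\<And>r. r \<le> i \<Longrightarrow> \<psi> r = (\<Sum>k\<le>i. c k * of_nat (r choose k))"
    using binomial_basis by meson
  define \<phi> :: "nat \<Rightarrow> complex" where
    "\<phi> = (\<lambda>t. \<Sum>k\<le>i. c k / of_nat ((j - k) choose (i - k)) * of_nat (t choose k))"
  have "(\<Sum>\<gamma>\<in>[V]\<^bsup>i\<^esup>. \<phi> (card (\<alpha> \<inter> \<gamma>)) * of_bool (card (\<gamma> \<inter> \<beta>) = i)) = \<psi> (card (\<alpha> \<inter> \<beta>))"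
    if ab: "\<alpha> \<in> [V]\<^bsup>i\<^esup>" "\<beta> \<in> [V]\<^bsup>j\<^esup>" for \<alpha> \<beta>
  proof -
    have "(\<Sum>\<gamma>\<in>[V]\<^bsup>i\<^esup>. \<phi> (card (\<alpha> \<inter> \<gamma>)) * of_bool (card (\<gamma> \<inter> \<beta>) = i))
        = (\<Sum>k\<le>i. \<Sum>\<gamma>\<in>[V]\<^bsup>i\<^esup>. c k / of_nat ((j - k) choose (i - k)) *
            (of_nat (card (\<alpha> \<inter> \<gamma>) choose k) * of_bool (card (\<gamma> \<inter> \<beta>) = i)))"
      unfolding \<phi>_def sum_distrib_right by (subst sum.swap) (simp add: mult_ac)
    also have "\<dots> = (\<Sum>k\<le>i. c k * of_nat (card (\<alpha> \<inter> \<beta>) choose k))"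
    proof (intro sum.cong refl)
      fix k assume "k \<in> {..i}"
      then have k: "k \<le> i" by simp
      have "(j - k) choose (i - k) \<noteq> 0" using k assms(2) by simp
      then have nz: "of_nat ((j - k) choose (i - k)) \<noteq> (0::complex)" by (metis of_nat_eq_0_iff)
      show "(\<Sum>\<gamma>\<in>[V]\<^bsup>i\<^esup>. c k / of_nat ((j - k) choose (i - k)) *
            (of_nat (card (\<alpha> \<inter> \<gamma>) choose k) * of_bool (card (\<gamma> \<inter> \<beta>) = i)))
          = c k * of_nat (card (\<alpha> \<inter> \<beta>) choose k)"
        unfolding sum_distrib_left[symmetric] sum_binomial_inclusion[OF assms(1) ab assms(2) k]
        using nz by simp
    qed
    also have "\<dots> = \<psi> (card (\<alpha> \<inter> \<beta>))"
    proof -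
      have "card (\<alpha> \<inter> \<beta>) \<le> i"
        using ab card_mono[of \<alpha> "\<alpha> \<inter> \<beta>"] by (auto simp: nsets_def)
      then show ?thesis using c by simp
    qed
    finally show ?thesis .
  qed
  then show ?thesis by blast
qed

lemma card_Int_complements:
  assumes "finite V" "a \<in> [V]\<^bsup>i\<^esup>" "b \<in> [V]\<^bsup>j\<^esup>"
  shows "card ((V - a) \<inter> (V - b)) + i + j = card V + card (a \<inter> b)"
proof -
  have *: "a \<subseteq> V" "b \<subseteq> V" "card a = i" "card b = j" "finite a" "finite b"
    using assms by (auto simp: nsets_def)
  have "card ((V - a) \<inter> (V - b)) = card V - card (a \<union> b)"
    using * by (simp add: card_Diff_subset flip: Diff_Un)
  moreover have "card (a \<union> b) \<le> card V" using * assms(1) by (intro card_mono) auto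
  moreover have "card (a \<union> b) + card (a \<inter> b) = i + j" using card_Un_Int[of a b] * by simp
  ultimately show ?thesis by linarith
qed

lemma bij_betw_complement_nsets:
  assumes "finite V" "k \<le> card V"
  shows "bij_betw (\<lambda>a. V - a) ([V]\<^bsup>k\<^esup>) ([V]\<^bsup>(card V - k)\<^esup>)"
  by (rule bij_betw_byWitness[where f' = "\<lambda>a. V - a"])
    (use assms in \<open>auto simp: nsets_def card_Diff_subset\<close>)

text \<open>Every function of \<open>|\<alpha> \<inter> \<beta>|\<close> on \<open>i\<close>-sets and \<open>j\<close>-sets is a product of a function of
  \<open>|\<alpha> \<inter> \<gamma>|\<close> on \<open>i\<close>-sets with the inclusion matrix. The case \<open>j < i\<close> is reduced to the previous
  lemma by taking complements.\<close>

lemma inclusion_generates: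
  fixes \<psi> :: "nat \<Rightarrow> complex"
  assumes V: "finite V" and "i \<le> card V" "j \<le> card V"
  shows "\<exists>\<phi>. \<forall>\<alpha>\<in>[V]\<^bsup>i\<^esup>. \<forall>\<beta>\<in>[V]\<^bsup>j\<^esup>.
    (\<Sum>\<gamma>\<in>[V]\<^bsup>i\<^esup>. \<phi> (card (\<alpha> \<inter> \<gamma>)) * of_bool (card (\<gamma> \<inter> \<beta>) = min i j)) = \<psi> (card (\<alpha> \<inter> \<beta>))"
proof (cases "i \<le> j")
  case True
  then show ?thesis using inclusion_generates_le[OF V True, of \<psi>] by (simp add: min_absorb1)
next
  case False
  define v where "v = card V"
  have ij: "j \<le> i" "i \<le> v" "j \<le> v" using False assms by (auto simp: v_def)
  obtain \<phi> where \<phi>: "\<And>\<alpha> \<beta>. \<alpha> \<in> [V]\<^bsup>(v - i)\<^esup> \<Longrightarrow> \<beta> \<in> [V]\<^bsup>(v - j)\<^esup> \<Longrightarrow>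
    (\<Sum>\<gamma>\<in>[V]\<^bsup>(v - i)\<^esup>. \<phi> (card (\<alpha> \<inter> \<gamma>)) * of_bool (card (\<gamma> \<inter> \<beta>) = v - i))
      = \<psi> (card (\<alpha> \<inter> \<beta>) + i + j - v)"
    using inclusion_generates_le[OF V, of "v - i" "v - j" "\<lambda>m. \<psi> (m + i + j - v)"] ij by fastforce
  have comp: "V - a \<in> [V]\<^bsup>(v - k)\<^esup>" if "a \<in> [V]\<^bsup>k\<^esup>" for a k
    using that V by (auto simp: nsets_def card_Diff_subset v_def)
  have "(\<Sum>\<gamma>\<in>[V]\<^bsup>i\<^esup>. \<phi> (v + card (\<alpha> \<inter> \<gamma>) - 2 * i) * of_bool (card (\<gamma> \<inter> \<beta>) = min i j))
      = \<psi> (card (\<alpha> \<inter> \<beta>))" if ab: "\<alpha> \<in> [V]\<^bsup>i\<^esup>" "\<beta> \<in> [V]\<^bsup>j\<^esup>" for \<alpha> \<beta>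
  proof -
    have "(\<Sum>\<gamma>\<in>[V]\<^bsup>i\<^esup>. \<phi> (v + card (\<alpha> \<inter> \<gamma>) - 2 * i) * of_bool (card (\<gamma> \<inter> \<beta>) = min i j))
        = (\<Sum>\<gamma>\<in>[V]\<^bsup>i\<^esup>. \<phi> (card ((V - \<alpha>) \<inter> (V - \<gamma>))) *
            of_bool (card ((V - \<gamma>) \<inter> (V - \<beta>)) = v - i))"
    proof (intro sum.cong refl)
      fix \<gamma> assume g: "\<gamma> \<in> [V]\<^bsup>i\<^esup>"
      have "card ((V - \<alpha>) \<inter> (V - \<gamma>)) = v + card (\<alpha> \<inter> \<gamma>) - 2 * i"
        using card_Int_complements[OF V ab(1) g] by (simp add: v_def)
      moreover have "card ((V - \<gamma>) \<inter> (V - \<beta>)) = v - i \<longleftrightarrow> card (\<gamma> \<inter> \<beta>) = min i j"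
        using card_Int_complements[OF V g ab(2)] ij by (auto simp: v_def)
      ultimately show "\<phi> (v + card (\<alpha> \<inter> \<gamma>) - 2 * i) * of_bool (card (\<gamma> \<inter> \<beta>) = min i j)
          = \<phi> (card ((V - \<alpha>) \<inter> (V - \<gamma>))) * of_bool (card ((V - \<gamma>) \<inter> (V - \<beta>)) = v - i)"
        by simp
    qed
    also have "\<dots> = (\<Sum>\<gamma>\<in>[V]\<^bsup>(v - i)\<^esup>. \<phi> (card ((V - \<alpha>) \<inter> \<gamma>)) *
            of_bool (card (\<gamma> \<inter> (V - \<beta>)) = v - i))"
      using bij_betw_complement_nsets[OF V, of i] ij
      by (intro sum.reindex_bij_betw) (simp add: v_def)
    also have "\<dots> = \<psi> (card (\<alpha> \<inter> \<beta>))"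
      unfolding \<phi>[OF comp[OF ab(1)] comp[OF ab(2)]]
      using card_Int_complements[OF V ab] by (simp add: v_def)
    finally show ?thesis .
  qed
  then show ?thesis by (intro exI[of _ "\<lambda>t. \<phi> (v + t - 2 * i)"]) blast
qed


section \<open>Permutation-invariant functions of sets\<close>

lemma card_eq_sum_of_bool_int:
  "finite V \<Longrightarrow> s \<subseteq> V \<Longrightarrow> int (card s) = (\<Sum>u\<in>V. of_bool (u \<in> s))"
  by (auto simp: sum.If_cases of_bool_def Int_absorb1)

text \<open>The orbit of a pair of sets under the permutations that preserve \<open>x\<close> is determined by
  the sizes of the intersections.\<close>

lemma exists_permutation_sets:
  assumes V: "finite V" "x \<subseteq> V" "y \<subseteq> V" "z \<subseteq> V" "y' \<subseteq> V" "z' \<subseteq> V"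
    and card: "card y = card y'" "card z = card z'" "card (x \<inter> y) = card (x \<inter> y')"
      "card (x \<inter> z) = card (x \<inter> z')" "card (y \<inter> z) = card (y' \<inter> z')"
      "card (x \<inter> (y \<inter> z)) = card (x \<inter> (y' \<inter> z'))"
  obtains \<pi> where "\<pi> permutes V" "\<pi> ` x = x" "\<pi> ` y = y'" "\<pi> ` z = z'"
proof -
  define f f' where "f = (\<lambda>u. (u \<in> x, u \<in> y, u \<in> z))" and "f' = (\<lambda>u. (u \<in> x, u \<in> y', u \<in> z'))"
  have s: "(\<Sum>u\<in>V. of_bool (u \<in> s)) = (\<Sum>u\<in>V. of_bool (u \<in> s') :: int)"
    if "s \<subseteq> V" "s' \<subseteq> V" "card s = card s'" for s s'
    using card_eq_sum_of_bool_int[OF V(1) that(1)] card_eq_sum_of_bool_int[OF V(1) that(2)] that(3)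
    by simp
  have prods: "(\<Sum>u\<in>V. of_bool (u \<in> y)) = (\<Sum>u\<in>V. of_bool (u \<in> y') :: int)"
    "(\<Sum>u\<in>V. of_bool (u \<in> z)) = (\<Sum>u\<in>V. of_bool (u \<in> z') :: int)"
    "(\<Sum>u\<in>V. of_bool (u \<in> x) * of_bool (u \<in> y)) = (\<Sum>u\<in>V. of_bool (u \<in> x) * of_bool (u \<in> y') :: int)"
    "(\<Sum>u\<in>V. of_bool (u \<in> x) * of_bool (u \<in> z)) = (\<Sum>u\<in>V. of_bool (u \<in> x) * of_bool (u \<in> z') :: int)"
    "(\<Sum>u\<in>V. of_bool (u \<in> y) * of_bool (u \<in> z)) = (\<Sum>u\<in>V. of_bool (u \<in> y') * of_bool (u \<in> z') :: int)"
    "(\<Sum>u\<in>V. of_bool (u \<in> x) * (of_bool (u \<in> y) * of_bool (u \<in> z))) =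
      (\<Sum>u\<in>V. of_bool (u \<in> x) * (of_bool (u \<in> y') * of_bool (u \<in> z')) :: int)"
    using s[of y y'] s[of z z'] s[of "x \<inter> y" "x \<inter> y'"] s[of "x \<inter> z" "x \<inter> z'"]
      s[of "y \<inter> z" "y' \<inter> z'"] s[of "x \<inter> (y \<inter> z)" "x \<inter> (y' \<inter> z')"] V card
    by (auto simp: of_bool_conj)
  \<comment> \<open>Inclusion and exclusion: the sizes of the eight cells are determined by those of the
    intersections. A membership indicator \<open>X\<close> or its negation has the form \<open>p\<^sub>0 + p\<^sub>1 X\<close>.\<close>
  have expand: "(\<Sum>u\<in>V. (p0 + p1 * X u) * ((q0 + q1 * Y u) * (r0 + r1 * Z u))) =
      p0 * q0 * r0 * int (card V) + p1 * q0 * r0 * (\<Sum>u\<in>V. X u) + p0 * q1 * r0 * (\<Sum>u\<in>V. Y u)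
      + p0 * q0 * r1 * (\<Sum>u\<in>V. Z u) + p1 * q1 * r0 * (\<Sum>u\<in>V. X u * Y u)
      + p1 * q0 * r1 * (\<Sum>u\<in>V. X u * Z u) + p0 * q1 * r1 * (\<Sum>u\<in>V. Y u * Z u)
      + p1 * q1 * r1 * (\<Sum>u\<in>V. X u * (Y u * Z u))"
    for p0 p1 q0 q1 r0 r1 :: int and X Y Z
    by (simp add: algebra_simps sum.distrib sum_distrib_left)
  have cell: "int (card {u\<in>V. h u = (p, q, r)}) =
      (\<Sum>u\<in>V. (of_bool (\<not> p) + (if p then 1 else -1) * of_bool (u \<in> x)) *
        ((of_bool (\<not> q) + (if q then 1 else -1) * of_bool (u \<in> a)) *
        (of_bool (\<not> r) + (if r then 1 else -1) * of_bool (u \<in> b))))"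
    if "h = (\<lambda>u. (u \<in> x, u \<in> a, u \<in> b))" for h p q r a b
    unfolding that card_eq_sum_of_bool_int[OF V(1) Collect_restrict]
  proof (intro sum.cong refl)
    fix u assume "u \<in> V"
    then show "of_bool (u \<in> {u \<in> V. (u \<in> x, u \<in> a, u \<in> b) = (p, q, r)}) =
      (of_bool (\<not> p) + (if p then 1 else -1) * of_bool (u \<in> x)) *
        ((of_bool (\<not> q) + (if q then 1 else -1) * of_bool (u \<in> a)) *
        (of_bool (\<not> r) + (if r then 1 else -1) * of_bool (u \<in> b)) :: int)"
      by (cases "u \<in> x"; cases "u \<in> a"; cases "u \<in> b"; cases p; cases q; cases r) simp_all
  qed
  have "image_mset f (mset_set V) = image_mset f' (mset_set V)"
  proof (rule multiset_eqI)
    fix c :: "bool \<times> bool \<times> bool"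
    obtain p q r where c: "c = (p, q, r)" by (cases c)
    have "int (card {u\<in>V. f u = (p, q, r)}) = int (card {u\<in>V. f' u = (p, q, r)})"
      unfolding cell[OF f_def] cell[OF f'_def] expand prods ..
    then show "count (image_mset f (mset_set V)) c = count (image_mset f' (mset_set V)) c"
      using V(1) by (simp add: c count_image_mset_eq_card_vimage)
  qed
  then obtain \<pi> where \<pi>: "\<pi> permutes V" "\<forall>u\<in>V. f u = f' (\<pi> u)"
    using image_mset_eq_implies_permutes[OF V(1)] by blast
  have im: "\<pi> ` s = s'" if "s \<subseteq> V" "s' \<subseteq> V" "\<And>u. u \<in> V \<Longrightarrow> u \<in> s \<longleftrightarrow> \<pi> u \<in> s'" for s s'
  proof
    show "\<pi> ` s \<subseteq> s'" using that by blast
    show "s' \<subseteq> \<pi> ` s"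
    proof
      fix v assume v: "v \<in> s'"
      then have "v \<in> \<pi> ` V" using that(2) permutes_image[OF \<pi>(1)] by auto
      then show "v \<in> \<pi> ` s" using that(3) v by auto
    qed
  qed
  show thesis
    by (rule that[OF \<pi>(1)]; rule im) (use V \<pi>(2) in \<open>auto simp: f_def f'_def\<close>)
qed

lemma bij_betw_image_nsets:
  assumes "\<pi> permutes V"
  shows "bij_betw ((`) \<pi>) ([V]\<^bsup>k\<^esup>) ([V]\<^bsup>k\<^esup>)"
proof (rule bij_betw_byWitness[where f' = "(`) (inv \<pi>)"])
  have sub: "(`) \<sigma> ` [V]\<^bsup>k\<^esup> \<subseteq> [V]\<^bsup>k\<^esup>" if "\<sigma> permutes V" for \<sigma>
    using permutes_in_image[OF that] permutes_inj_on[OF that]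
    by (auto simp: nsets_def card_image)
  show "(`) \<pi> ` [V]\<^bsup>k\<^esup> \<subseteq> [V]\<^bsup>k\<^esup>" "(`) (inv \<pi>) ` [V]\<^bsup>k\<^esup> \<subseteq> [V]\<^bsup>k\<^esup>"
    using sub assms permutes_inv by blast+
qed (simp_all add: image_comp permutes_inv_o[OF assms])

text \<open>A product of two matrices whose entries depend only on the size of the intersection of the
  indices has the same property, since it is invariant under all permutations of \<open>V\<close>.\<close>

lemma convolution_intersection_function:
  fixes \<phi> \<psi> :: "nat \<Rightarrow> complex"
  assumes V: "finite V"
  shows "\<exists>\<chi>. \<forall>\<alpha>\<in>[V]\<^bsup>i\<^esup>. \<forall>\<beta>\<in>[V]\<^bsup>k\<^esup>.
    (\<Sum>\<gamma>\<in>[V]\<^bsup>j\<^esup>. \<phi> (card (\<alpha> \<inter> \<gamma>)) * \<psi> (card (\<gamma> \<inter> \<beta>))) = \<chi> (card (\<alpha> \<inter> \<beta>))"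
proof -
  define F where "F = (\<lambda>(\<alpha>, \<beta>). \<Sum>\<gamma>\<in>[V]\<^bsup>j\<^esup>. \<phi> (card (\<alpha> \<inter> \<gamma>)) * \<psi> (card (\<gamma> \<inter> \<beta>)))"
  have eq: "F (\<alpha>, \<beta>) = F (\<alpha>', \<beta>')" if ab: "\<alpha> \<in> [V]\<^bsup>i\<^esup>" "\<beta> \<in> [V]\<^bsup>k\<^esup>" "\<alpha>' \<in> [V]\<^bsup>i\<^esup>" "\<beta>' \<in> [V]\<^bsup>k\<^esup>"
    and c: "card (\<alpha> \<inter> \<beta>) = card (\<alpha>' \<inter> \<beta>')" for \<alpha> \<beta> \<alpha>' \<beta>'
  proof -
    obtain \<pi> where \<pi>: "\<pi> permutes V" "\<pi> ` \<alpha> = \<alpha>'" "\<pi> ` \<beta> = \<beta>'"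
      using exists_permutation_sets[of V "{}" \<alpha> \<beta> \<alpha>' \<beta>'] V ab c by (auto simp: nsets_def)
    have inj: "inj \<pi>" using \<pi>(1) by (rule permutes_inj)
    have card: "card (\<pi> ` a \<inter> \<pi> ` b) = card (a \<inter> b)" for a b
      by (simp add: card_image[OF inj_on_subset[OF inj subset_UNIV]] flip: image_Int[OF inj])
    have "F (\<alpha>', \<beta>') = (\<Sum>\<gamma>\<in>[V]\<^bsup>j\<^esup>. \<phi> (card (\<alpha>' \<inter> \<pi> ` \<gamma>)) * \<psi> (card (\<pi> ` \<gamma> \<inter> \<beta>')))"
      unfolding F_def prod.case
      using bij_betw_image_nsets[OF \<pi>(1)] by (rule sum.reindex_bij_betw[symmetric])
    also have "\<dots> = F (\<alpha>, \<beta>)"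
      by (simp add: F_def card flip: \<pi>(2,3))
    finally show ?thesis by simp
  qed
  have "\<exists>\<chi>. \<forall>p. p \<in> [V]\<^bsup>i\<^esup> \<times> [V]\<^bsup>k\<^esup> \<longrightarrow> F p = \<chi> (case p of (\<alpha>, \<beta>) \<Rightarrow> card (\<alpha> \<inter> \<beta>))"
    by (rule function_factors_left_gen[THEN iffD1]) (use eq in auto)
  then show ?thesis unfolding F_def by fast
qed


section \<open>The distance-one matrix generates the Bose-Mesner algebra\<close>

lemma card_Int_exchange_le:
  assumes "finite a" "finite c" "card a = card c" "Suc (card (a \<inter> c)) = card a"
  shows "card (c \<inter> b) \<le> Suc (card (a \<inter> b))"
proof -
  have "card (c \<inter> b) \<le> card ((a \<inter> b) \<union> (c - a))"
    using assms by (intro card_mono) auto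
  also have "\<dots> \<le> card (a \<inter> b) + card (c - a)" by (rule card_Un_le)
  also have "card (c - a) = 1"
    using assms card_Diff_subset_Int[of c a] by (simp add: Int_commute)
  finally show ?thesis by simp
qed

lemma card_Int_eq_iff_nsets:
  assumes "\<alpha> \<in> [V]\<^bsup>m\<^esup>" "\<gamma> \<in> [V]\<^bsup>m\<^esup>"
  shows "card (\<alpha> \<inter> \<gamma>) = m \<longleftrightarrow> \<gamma> = \<alpha>"
  using assms card_Int_eq_left_iff[of \<alpha> \<gamma>] card_subset_eq[of \<gamma> \<alpha>] by (auto simp: nsets_def)

lemma sum_identity_left:
  fixes \<psi> :: "nat \<Rightarrow> complex"
  assumes "finite V" "\<alpha> \<in> [V]\<^bsup>m\<^esup>"
  shows "(\<Sum>\<gamma>\<in>[V]\<^bsup>m\<^esup>. of_bool (card (\<alpha> \<inter> \<gamma>) = m) * \<psi> (card (\<gamma> \<inter> \<beta>))) = \<psi> (card (\<alpha> \<inter> \<beta>))"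
proof -
  have "(\<Sum>\<gamma>\<in>[V]\<^bsup>m\<^esup>. of_bool (card (\<alpha> \<inter> \<gamma>) = m) * \<psi> (card (\<gamma> \<inter> \<beta>)))
      = (\<Sum>\<gamma>\<in>[V]\<^bsup>m\<^esup>. if \<gamma> = \<alpha> then \<psi> (card (\<alpha> \<inter> \<beta>)) else 0)"
    using assms by (intro sum.cong) (auto simp: card_Int_eq_iff_nsets)
  then show ?thesis using assms finite_imp_finite_nsets[OF assms(1)] by simp
qed

lemma sum_identity_right:
  fixes \<phi> :: "nat \<Rightarrow> complex"
  assumes "finite V" "\<beta> \<in> [V]\<^bsup>m\<^esup>"
  shows "(\<Sum>\<gamma>\<in>[V]\<^bsup>m\<^esup>. \<phi> (card (\<alpha> \<inter> \<gamma>)) * of_bool (card (\<gamma> \<inter> \<beta>) = m)) = \<phi> (card (\<alpha> \<inter> \<beta>))"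
  using sum_identity_left[OF assms, of \<phi> \<alpha>] by (simp add: Int_commute mult.commute)

text \<open>The set \<open>F\<close> plays the role of the functions \<open>\<phi>\<close> for which the matrix with entries
  \<open>\<phi> (|\<alpha> \<inter> \<beta>|)\<close> lies in a given algebra. Multiplying the matrix of the relation \<open>|\<alpha> \<inter> \<beta>| = t + 1\<close>
  by the adjacency matrix gives a combination of the relations with \<open>t\<close>, \<open>t + 1\<close> and \<open>t + 2\<close>,
  in which the coefficient of the first one is nonzero; hence all relations are obtained by descent
  from \<open>t = m\<close>. The coefficients are not computed: only the support of the product and one positive
  entry are needed.\<close>

lemma johnson_generated_by_adjacency:
  fixes F :: "(nat \<Rightarrow> complex) set"
  assumes V: "finite V"
    and add: "\<And>\<phi> \<psi>. \<phi> \<in> F \<Longrightarrow> \<psi> \<in> F \<Longrightarrow> (\<lambda>t. \<phi> t + \<psi> t) \<in> F"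
    and scale: "\<And>c \<phi>. \<phi> \<in> F \<Longrightarrow> (\<lambda>t. c * \<phi> t) \<in> F"
    and conv: "\<And>\<phi> \<psi> \<chi>. \<phi> \<in> F \<Longrightarrow> \<psi> \<in> F \<Longrightarrow> \<forall>\<alpha>\<in>[V]\<^bsup>m\<^esup>. \<forall>\<beta>\<in>[V]\<^bsup>m\<^esup>.
      (\<Sum>\<gamma>\<in>[V]\<^bsup>m\<^esup>. \<phi> (card (\<alpha> \<inter> \<gamma>)) * \<psi> (card (\<gamma> \<inter> \<beta>))) = \<chi> (card (\<alpha> \<inter> \<beta>)) \<Longrightarrow> \<chi> \<in> F"
    and one: "(\<lambda>t. of_bool (t = m)) \<in> F"
    and adj: "(\<lambda>t. of_bool (Suc t = m)) \<in> F"
  shows "\<phi> \<in> F"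
proof -
  \<comment> \<open>Sizes that are not intersection sizes impose no condition: the matrix does not see them.\<close>
  define occurs where "occurs = (\<lambda>t. \<exists>\<alpha>\<in>[V]\<^bsup>m\<^esup>. \<exists>\<beta>\<in>[V]\<^bsup>m\<^esup>. card (\<alpha> \<inter> \<beta>) = t)"
  have fin: "finite ([V]\<^bsup>m\<^esup>)" using V by (rule finite_imp_finite_nsets)
  have cong: "\<chi> \<in> F" if "\<psi> \<in> F" "\<And>t. occurs t \<Longrightarrow> \<chi> t = \<psi> t" for \<chi> \<psi>
  proof (rule conv[OF one that(1)], intro ballI)
    fix \<alpha> \<beta> assume ab: "\<alpha> \<in> [V]\<^bsup>m\<^esup>" "\<beta> \<in> [V]\<^bsup>m\<^esup>"
    have "(\<Sum>\<gamma>\<in>[V]\<^bsup>m\<^esup>. of_bool (card (\<alpha> \<inter> \<gamma>) = m) * \<psi> (card (\<gamma> \<inter> \<beta>))) = \<psi> (card (\<alpha> \<inter> \<beta>))"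
      using V ab(1) by (rule sum_identity_left)
    also have "\<dots> = \<chi> (card (\<alpha> \<inter> \<beta>))" proof -
      have "occurs (card (\<alpha> \<inter> \<beta>))" using ab unfolding occurs_def by blast
      then show ?thesis using that(2) by simp
    qed
    finally show "(\<Sum>\<gamma>\<in>[V]\<^bsup>m\<^esup>. of_bool (card (\<alpha> \<inter> \<gamma>) = m) * \<psi> (card (\<gamma> \<inter> \<beta>))) = \<chi> (card (\<alpha> \<inter> \<beta>))" .
  qed
  have zero: "(\<lambda>t. 0) \<in> F" using scale[OF one, of 0] by simp
  have step: "(\<lambda>r. of_bool (r = t)) \<in> F"
    if t: "Suc (Suc t) \<le> m" and IH: "(\<lambda>r. of_bool (r = Suc t)) \<in> F" "(\<lambda>r. of_bool (r = Suc (Suc t))) \<in> F"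
    for t
  proof -
    obtain \<chi> :: "nat \<Rightarrow> complex" where \<chi>: "\<forall>\<alpha>\<in>[V]\<^bsup>m\<^esup>. \<forall>\<beta>\<in>[V]\<^bsup>m\<^esup>.
      (\<Sum>\<gamma>\<in>[V]\<^bsup>m\<^esup>. of_bool (Suc (card (\<alpha> \<inter> \<gamma>)) = m) * of_bool (card (\<gamma> \<inter> \<beta>) = Suc t))
        = \<chi> (card (\<alpha> \<inter> \<beta>))"
      using convolution_intersection_function[OF V, where i = m and j = m and k = m and
          \<phi> = "\<lambda>r. of_bool (Suc r = m)" and \<psi> = "\<lambda>r. of_bool (r = Suc t)"] by blast
    have inF: "\<chi> \<in> F" by (rule conv[OF adj IH(1) \<chi>])
    define G where "G = (\<lambda>\<alpha> \<beta>. {\<gamma>\<in>[V]\<^bsup>m\<^esup>. Suc (card (\<alpha> \<inter> \<gamma>)) = m \<and> card (\<gamma> \<inter> \<beta>) = Suc t})"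
    have \<chi>G: "\<chi> (card (\<alpha> \<inter> \<beta>)) = of_nat (card (G \<alpha> \<beta>))" if "\<alpha> \<in> [V]\<^bsup>m\<^esup>" "\<beta> \<in> [V]\<^bsup>m\<^esup>" for \<alpha> \<beta>
      using \<chi> that unfolding G_def sum_of_bool_eq_card[OF fin, symmetric] of_bool_conj by simp
    have supp: "r \<in> {t, Suc t, Suc (Suc t)}" if occ: "occurs r" and ne: "\<chi> r \<noteq> 0" for r
    proof -
      obtain \<alpha> \<beta> where ab: "\<alpha> \<in> [V]\<^bsup>m\<^esup>" "\<beta> \<in> [V]\<^bsup>m\<^esup>" "r = card (\<alpha> \<inter> \<beta>)"
        using occ unfolding occurs_def by blast
      have "G \<alpha> \<beta> \<noteq> {}" using ne \<chi>G[OF ab(1,2)] ab(3) by auto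
      then obtain \<gamma> where g: "\<gamma> \<in> [V]\<^bsup>m\<^esup>" "Suc (card (\<alpha> \<inter> \<gamma>)) = m" "card (\<gamma> \<inter> \<beta>) = Suc t"
        by (auto simp: G_def)
      have "card (\<gamma> \<inter> \<beta>) \<le> Suc (card (\<alpha> \<inter> \<beta>))" "card (\<alpha> \<inter> \<beta>) \<le> Suc (card (\<gamma> \<inter> \<beta>))"
        using g ab card_Int_exchange_le[of \<alpha> \<gamma> \<beta>] card_Int_exchange_le[of \<gamma> \<alpha> \<beta>]
        by (simp_all add: nsets_def Int_commute)
      then show ?thesis using g ab by auto
    qed
    have nonzero: "\<chi> t \<noteq> 0" if occ: "occurs t"
    proof -
      obtain \<alpha> \<beta> where ab: "\<alpha> \<in> [V]\<^bsup>m\<^esup>" "\<beta> \<in> [V]\<^bsup>m\<^esup>" "card (\<alpha> \<inter> \<beta>) = t"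
        using occ unfolding occurs_def by blast
      then have *: "finite \<alpha>" "finite \<beta>" "card \<alpha> = m" "card \<beta> = m" "\<alpha> \<subseteq> V" "\<beta> \<subseteq> V"
        by (auto simp: nsets_def)
      have "\<not> \<alpha> \<subseteq> \<beta>" "\<not> \<beta> \<subseteq> \<alpha>"
        using ab * t by (auto simp: Int_absorb1 Int_absorb2)
      then obtain u v where uv: "u \<in> \<alpha>" "u \<notin> \<beta>" "v \<in> \<beta>" "v \<notin> \<alpha>" by blast
      \<comment> \<open>One exchange moves \<open>\<alpha>\<close> towards \<open>\<beta>\<close>, so the sum of nonnegative terms has a positive one.\<close>
      define \<gamma> where "\<gamma> = insert v (\<alpha> - {u})"
      have "\<alpha> \<inter> \<gamma> = \<alpha> - {u}" "\<gamma> \<inter> \<beta> = insert v (\<alpha> \<inter> \<beta>)" using uv by (auto simp: \<gamma>_def)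
      then have "\<gamma> \<in> G \<alpha> \<beta>"
        using uv * ab t by (auto simp: G_def \<gamma>_def nsets_def)
      moreover have "finite (G \<alpha> \<beta>)" using fin by (auto simp: G_def)
      ultimately have "card (G \<alpha> \<beta>) \<noteq> 0" by auto
      then show ?thesis using \<chi>G[OF ab(1,2)] ab(3) by simp
    qed
    show ?thesis
    proof (cases "occurs t")
      case False
      then show ?thesis by (intro cong[OF zero]) auto
    next
      case True
      have "(\<lambda>r. 1 / \<chi> t * (\<chi> r + (- \<chi> (Suc t) * of_bool (r = Suc t)
          + - \<chi> (Suc (Suc t)) * of_bool (r = Suc (Suc t))))) \<in> F"
        by (intro scale add inF IH)
      then show ?thesis
        by (rule cong) (use supp nonzero[OF True] in force)
    qed
  qed
  have delta: "(\<lambda>r. of_bool (r = m - k)) \<in> F \<and> (Suc k \<le> m \<longrightarrow> (\<lambda>r. of_bool (r = m - Suc k)) \<in> F)"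
    if "k \<le> m" for k
    using that
  proof (induction k)
    case 0
    have "(\<lambda>r. of_bool (r = m - Suc 0)) = (\<lambda>t. of_bool (Suc t = m) :: complex)" if "Suc 0 \<le> m"
      using that by (auto simp: fun_eq_iff)
    then show ?case using one adj by simp
  next
    case (Suc k)
    have "(\<lambda>r. of_bool (r = m - Suc (Suc k))) \<in> F" if "Suc (Suc k) \<le> m"
    proof (rule step)
      have "Suc (m - Suc (Suc k)) = m - Suc k" "Suc (Suc (m - Suc (Suc k))) = m - k"
        using that by auto
      then show "(\<lambda>r. of_bool (r = Suc (m - Suc (Suc k)))) \<in> F"
        "(\<lambda>r. of_bool (r = Suc (Suc (m - Suc (Suc k))))) \<in> F"
        using Suc that by auto
    qed (use that in auto)
    then show ?case using Suc by auto
  qed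
  have lin: "(\<lambda>r. \<Sum>t\<in>S. c t * of_bool (r = t)) \<in> F" if "finite S" "S \<subseteq> {..m}" for S and c :: "nat \<Rightarrow> complex"
    using that
  proof (induction S)
    case empty
    then show ?case using zero by simp
  next
    case (insert t S)
    then have "(\<lambda>r. of_bool (r = t)) \<in> F" using delta[of "m - t"] by simp
    moreover have "(\<lambda>r. \<Sum>t\<in>S. c t * of_bool (r = t)) \<in> F" using insert by blast
    ultimately show ?case unfolding sum.insert[OF insert.hyps] by (intro add scale)
  qed
  show ?thesis
  proof (rule cong[OF lin[of "{..m}" \<phi>]])
    fix t assume "occurs t"
    then have "t \<le> m" by (auto simp: occurs_def nsets_def intro!: card_mono)
    then show "\<phi> t = (\<Sum>s\<le>m. \<phi> s * of_bool (t = s))" by simp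
  qed auto
qed


section \<open>The block spaces\<close>

text \<open>The matrix indexed by \<open>i\<close>-subsets and \<open>j\<close>-subsets of \<open>V\<close> with entries \<open>\<phi> (|\<alpha> \<inter> \<beta>|)\<close>.\<close>

definition intersection_kernel ::
    "'a set \<Rightarrow> nat \<Rightarrow> nat \<Rightarrow> (nat \<Rightarrow> complex) \<Rightarrow> ('a set, 'a set) cmatrix" where
  "intersection_kernel V i j \<phi> =
     (\<lambda>\<alpha> \<beta>. if \<alpha> \<in> [V]\<^bsup>i\<^esup> \<and> \<beta> \<in> [V]\<^bsup>j\<^esup> then \<phi> (card (\<alpha> \<inter> \<beta>)) else 0)"

text \<open>Its analogue on pairs of sets, with entries depending on the two intersection sizes.\<close>

definition pair_kernel ::
    "nat \<Rightarrow> nat \<Rightarrow> nat \<Rightarrow> nat \<Rightarrow> (nat \<Rightarrow> nat \<Rightarrow> complex) \<Rightarrow>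
     (nat set \<times> nat set, nat set \<times> nat set) cmatrix" where
  "pair_kernel n d i j \<phi> = (\<lambda>(\<alpha>, \<beta>) (\<alpha>', \<beta>').
     if \<alpha> \<in> [{1..d}]\<^bsup>(d - i)\<^esup> \<and> \<alpha>' \<in> [{1..d}]\<^bsup>(d - j)\<^esup> \<and> \<beta> \<in> [{1..n - d}]\<^bsup>i\<^esup> \<and> \<beta>' \<in> [{1..n - d}]\<^bsup>j\<^esup>
     then \<phi> (card (\<alpha> \<inter> \<alpha>')) (card (\<beta> \<inter> \<beta>')) else 0)"

lemma subspace_intersection_kernels: "cmat.subspace (range (intersection_kernel V i j))"
proof (rule cmat.subspaceI)
  show "0 \<in> range (intersection_kernel V i j)"
    by (rule image_eqI[of _ _ "\<lambda>_. 0"]) (auto simp: intersection_kernel_def fun_eq_iff)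
next
  fix A B assume "A \<in> range (intersection_kernel V i j)" "B \<in> range (intersection_kernel V i j)"
  then obtain \<phi> \<psi> where "A = intersection_kernel V i j \<phi>" "B = intersection_kernel V i j \<psi>" by blast
  then show "A + B \<in> range (intersection_kernel V i j)"
    by (intro image_eqI[of _ _ "\<lambda>t. \<phi> t + \<psi> t"]) (auto simp: intersection_kernel_def fun_eq_iff)
next
  fix c A assume "A \<in> range (intersection_kernel V i j)"
  then obtain \<phi> where "A = intersection_kernel V i j \<phi>" by blast
  then show "cmat_scale c A \<in> range (intersection_kernel V i j)"
    by (intro image_eqI[of _ _ "\<lambda>t. c * \<phi> t"])
      (auto simp: intersection_kernel_def cmat_scale_def fun_eq_iff)
qed

lemma subspace_pair_kernels: "cmat.subspace (range (pair_kernel n d i j))"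
proof (rule cmat.subspaceI)
  show "0 \<in> range (pair_kernel n d i j)"
    by (rule image_eqI[of _ _ "\<lambda>_ _. 0"]) (auto simp: pair_kernel_def fun_eq_iff)
next
  fix A B assume "A \<in> range (pair_kernel n d i j)" "B \<in> range (pair_kernel n d i j)"
  then obtain \<phi> \<psi> where "A = pair_kernel n d i j \<phi>" "B = pair_kernel n d i j \<psi>" by blast
  then show "A + B \<in> range (pair_kernel n d i j)"
    by (intro image_eqI[of _ _ "\<lambda>r s. \<phi> r s + \<psi> r s"]) (auto simp: pair_kernel_def fun_eq_iff)
next
  fix c A assume "A \<in> range (pair_kernel n d i j)"
  then obtain \<phi> where "A = pair_kernel n d i j \<phi>" by blast
  then show "cmat_scale c A \<in> range (pair_kernel n d i j)"
    by (intro image_eqI[of _ _ "\<lambda>r s. c * \<phi> r s"])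
      (auto simp: pair_kernel_def cmat_scale_def fun_eq_iff)
qed

lemma card_Int_le_nsets: "\<alpha> \<in> [V]\<^bsup>i\<^esup> \<Longrightarrow> card (\<alpha> \<inter> \<beta>) \<le> i" "\<alpha> \<in> [V]\<^bsup>i\<^esup> \<Longrightarrow> card (\<beta> \<inter> \<alpha>) \<le> i"
  by (auto simp: nsets_def intro!: card_mono)

lemma bose_mesner_eq: "bose_mesner v k = range (intersection_kernel {1..v} k k)"
proof
  have "intersection_matrix r k k v = intersection_kernel {1..v} k k (\<lambda>t. of_bool (t = r))" for r
    by (auto simp: intersection_matrix_def intersection_kernel_def fun_eq_iff)
  then show "bose_mesner v k \<subseteq> range (intersection_kernel {1..v} k k)"
    unfolding bose_mesner_def by (intro cmat.span_minimal subspace_intersection_kernels) auto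
  show "range (intersection_kernel {1..v} k k) \<subseteq> bose_mesner v k"
  proof clarify
    fix \<phi>
    have "intersection_kernel {1..v} k k \<phi> =
        (\<Sum>r\<in>{0..k}. cmat_scale (\<phi> r) (intersection_matrix r k k v))" (is "?l = ?r")
    proof (intro ext)
      fix \<alpha> \<beta>
      show "?l \<alpha> \<beta> = ?r \<alpha> \<beta>"
        using card_Int_le_nsets(1)[of \<alpha> "{1..v}" k \<beta>]
        by (auto simp: sum_fun2_apply cmat_scale_def intersection_kernel_def intersection_matrix_def
            of_bool_def if_distrib cong: if_cong)
    qed
    also have "\<dots> \<in> bose_mesner v k"
      unfolding bose_mesner_def
      by (intro cmat.span_sum cmat.span_scale cmat.span_base) auto
    finally show "intersection_kernel {1..v} k k \<phi> \<in> bose_mesner v k" .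
  qed
qed

lemma cmat_mult_intersection_kernel:
  assumes "finite V"
  shows "cmat_mult ([V]\<^bsup>j\<^esup>) (intersection_kernel V i j \<phi>) (intersection_kernel V j k \<psi>) =
    (\<lambda>\<alpha> \<beta>. if \<alpha> \<in> [V]\<^bsup>i\<^esup> \<and> \<beta> \<in> [V]\<^bsup>k\<^esup>
       then \<Sum>\<gamma>\<in>[V]\<^bsup>j\<^esup>. \<phi> (card (\<alpha> \<inter> \<gamma>)) * \<psi> (card (\<gamma> \<inter> \<beta>)) else 0)"
  by (auto simp: cmat_mult_def intersection_kernel_def fun_eq_iff)

text \<open>Although it is defined by products with a single inclusion matrix, the space \<open>\<B>\<^bsup>(v,i)\<^esup> H\<^bsub>i,j\<^esub>(v)\<close>
  contains every matrix whose entries depend only on \<open>|\<alpha> \<inter> \<beta>|\<close>.\<close>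

lemma bose_mesner_inclusion_eq:
  assumes "i \<le> v" "j \<le> v"
  shows "bose_mesner_inclusion v i j = range (intersection_kernel {1..v} i j)"
proof -
  let ?V = "{1..v}" and ?h = "\<lambda>t. of_bool (t = min i j) :: complex"
  have H: "inclusion_matrix i j v = intersection_kernel ?V i j ?h"
    by (auto simp: intersection_matrix_def intersection_kernel_def fun_eq_iff)
  have mult: "cmat_mult ([?V]\<^bsup>i\<^esup>) (intersection_kernel ?V i i \<phi>) (intersection_kernel ?V i j ?h)
      = intersection_kernel ?V i j \<chi>"
    if "\<forall>\<alpha>\<in>[?V]\<^bsup>i\<^esup>. \<forall>\<beta>\<in>[?V]\<^bsup>j\<^esup>.
      (\<Sum>\<gamma>\<in>[?V]\<^bsup>i\<^esup>. \<phi> (card (\<alpha> \<inter> \<gamma>)) * of_bool (card (\<gamma> \<inter> \<beta>) = min i j)) = \<chi> (card (\<alpha> \<inter> \<beta>))"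
    for \<phi> \<chi>
    unfolding cmat_mult_intersection_kernel[OF finite_atLeastAtMost]
    using that by (auto simp: intersection_kernel_def fun_eq_iff)
  have "bose_mesner_inclusion v i j = (\<lambda>\<phi>. cmat_mult ([?V]\<^bsup>i\<^esup>) (intersection_kernel ?V i i \<phi>)
      (intersection_kernel ?V i j ?h)) ` UNIV"
    unfolding bose_mesner_inclusion_def bose_mesner_eq H by (simp only: image_image)
  also have "\<dots> = range (intersection_kernel ?V i j)"
  proof (intro equalityI subsetI)
    fix A assume "A \<in> (\<lambda>\<phi>. cmat_mult ([?V]\<^bsup>i\<^esup>) (intersection_kernel ?V i i \<phi>)
      (intersection_kernel ?V i j ?h)) ` UNIV"
    then obtain \<phi> where A: "A = cmat_mult ([?V]\<^bsup>i\<^esup>) (intersection_kernel ?V i i \<phi>)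
      (intersection_kernel ?V i j ?h)" by blast
    obtain \<chi> where "A = intersection_kernel ?V i j \<chi>"
      using mult[of \<phi>] convolution_intersection_function[OF finite_atLeastAtMost,
          where i = i and j = i and k = j and \<phi> = \<phi> and \<psi> = ?h] A by blast
    then show "A \<in> range (intersection_kernel ?V i j)" by blast
  next
    fix A assume "A \<in> range (intersection_kernel ?V i j)"
    then obtain \<psi> where A: "A = intersection_kernel ?V i j \<psi>" by blast
    obtain \<phi> where "\<forall>\<alpha>\<in>[?V]\<^bsup>i\<^esup>. \<forall>\<beta>\<in>[?V]\<^bsup>j\<^esup>.
      (\<Sum>\<gamma>\<in>[?V]\<^bsup>i\<^esup>. \<phi> (card (\<alpha> \<inter> \<gamma>)) * of_bool (card (\<gamma> \<inter> \<beta>) = min i j)) = \<psi> (card (\<alpha> \<inter> \<beta>))"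
      using inclusion_generates[OF finite_atLeastAtMost, of i 1 v j \<psi>] assms by auto
    from mult[OF this] A
    have "A = cmat_mult ([?V]\<^bsup>i\<^esup>) (intersection_kernel ?V i i \<phi>) (intersection_kernel ?V i j ?h)" by simp
    then show "A \<in> (\<lambda>\<phi>. cmat_mult ([?V]\<^bsup>i\<^esup>) (intersection_kernel ?V i i \<phi>)
      (intersection_kernel ?V i j ?h)) ` UNIV" by blast
  qed
  finally show ?thesis .
qed

lemma block_space_eq:
  assumes "i \<le> d" "j \<le> d" "2 * d \<le> n"
  shows "block_space n d i j = range (pair_kernel n d i j)"
proof -
  have bm: "bose_mesner_inclusion d (d - i) (d - j) = range (intersection_kernel {1..d} (d - i) (d - j))"
    "bose_mesner_inclusion (n - d) i j = range (intersection_kernel {1..n - d} i j)"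
    using assms by (auto simp: bose_mesner_inclusion_eq)
  have kron: "kronecker (intersection_kernel {1..d} (d - i) (d - j) \<phi>) (intersection_kernel {1..n - d} i j \<psi>)
      = pair_kernel n d i j (\<lambda>r s. \<phi> r * \<psi> s)" for \<phi> \<psi>
    by (auto simp: kronecker_def intersection_kernel_def pair_kernel_def fun_eq_iff)
  have space: "block_space n d i j = cmat.span {pair_kernel n d i j (\<lambda>r s. \<phi> r * \<psi> s) | \<phi> \<psi>. True}"
    unfolding block_space_def bm
  proof (rule arg_cong[of _ _ cmat.span], intro equalityI subsetI)
    fix A assume "A \<in> {pair_kernel n d i j (\<lambda>r s. \<phi> r * \<psi> s) | \<phi> \<psi>. True}"
    then obtain \<phi> \<psi> where "A = kronecker (intersection_kernel {1..d} (d - i) (d - j) \<phi>)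
        (intersection_kernel {1..n - d} i j \<psi>)" using kron by auto
    then show "A \<in> {kronecker P Q |P Q. P \<in> range (intersection_kernel {1..d} (d - i) (d - j)) \<and>
        Q \<in> range (intersection_kernel {1..n - d} i j)}"
      by blast
  next
    fix A assume "A \<in> {kronecker P Q |P Q. P \<in> range (intersection_kernel {1..d} (d - i) (d - j)) \<and>
        Q \<in> range (intersection_kernel {1..n - d} i j)}"
    then obtain \<phi> \<psi> where "A = kronecker (intersection_kernel {1..d} (d - i) (d - j) \<phi>)
        (intersection_kernel {1..n - d} i j \<psi>)" by blast
    then show "A \<in> {pair_kernel n d i j (\<lambda>r s. \<phi> r * \<psi> s) | \<phi> \<psi>. True}"
      unfolding kron by blast
  qed
  have gen: "pair_kernel n d i j (\<lambda>r s. \<phi> r * \<psi> s)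
      \<in> cmat.span {pair_kernel n d i j (\<lambda>r s. \<phi> r * \<psi> s) | \<phi> \<psi>. True}" for \<phi> \<psi>
    by (rule cmat.span_base) blast
  show ?thesis
  proof
    show "block_space n d i j \<subseteq> range (pair_kernel n d i j)"
      unfolding space by (intro cmat.span_minimal subspace_pair_kernels) auto
    show "range (pair_kernel n d i j) \<subseteq> block_space n d i j"
    proof clarify
      fix \<phi>
      have "pair_kernel n d i j \<phi> = (\<Sum>r\<in>{0..d}. \<Sum>s\<in>{0..d}.
        cmat_scale (\<phi> r s) (pair_kernel n d i j (\<lambda>r' s'. of_bool (r' = r) * of_bool (s' = s))))"
        (is "?l = ?r")
      proof (intro ext)
        fix p q :: "nat set \<times> nat set"
        obtain \<alpha> \<beta> \<alpha>' \<beta>' where pq: "p = (\<alpha>, \<beta>)" "q = (\<alpha>', \<beta>')" by (cases p; cases q)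
        show "?l p q = ?r p q"
        proof (cases "\<alpha> \<in> [{1..d}]\<^bsup>(d - i)\<^esup> \<and> \<alpha>' \<in> [{1..d}]\<^bsup>(d - j)\<^esup> \<and> \<beta> \<in> [{1..n - d}]\<^bsup>i\<^esup> \<and>
            \<beta>' \<in> [{1..n - d}]\<^bsup>j\<^esup>")
          case True
          then have "card (\<alpha> \<inter> \<alpha>') \<le> d" "card (\<beta> \<inter> \<beta>') \<le> d"
            using card_Int_le_nsets(1)[of \<alpha> "{1..d}" "d - i" \<alpha>']
              card_Int_le_nsets(1)[of \<beta> "{1..n - d}" i \<beta>'] assms by auto
          moreover have "?r p q = (\<Sum>r\<in>{0..d}. \<Sum>s\<in>{0..d}.
              if card (\<alpha> \<inter> \<alpha>') = r then if card (\<beta> \<inter> \<beta>') = s then \<phi> r s else 0 else 0)"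
            using True unfolding sum_fun2_apply pq
            by (intro sum.cong refl) (auto simp: cmat_scale_def pair_kernel_def)
          moreover have "\<dots> = (\<Sum>r\<in>{0..d}. if card (\<alpha> \<inter> \<alpha>') = r then \<Sum>s\<in>{0..d}.
              if card (\<beta> \<inter> \<beta>') = s then \<phi> r s else 0 else 0)"
            by (intro sum.cong) auto
          ultimately show ?thesis using True by (simp add: pq pair_kernel_def)
        qed (auto simp: sum_fun2_apply pq cmat_scale_def pair_kernel_def)
      qed
      also have "\<dots> \<in> block_space n d i j"
        unfolding space by (intro cmat.span_sum cmat.span_scale gen)
      finally show "pair_kernel n d i j \<phi> \<in> block_space n d i j" .
    qed
  qed
qed


section \<open>Matrices constant on the orbits of the stabilizer\<close>

text \<open>The matrix supported on the block \<open>\<Omega>\<^sub>i \<times> \<Omega>\<^sub>j\<close> whose entries depend only on the sizes of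
  \<open>y \<inter> z \<inter> x\<close> and \<open>(y \<inter> z) - x\<close>.\<close>

definition orbit_block ::
    "nat \<Rightarrow> nat \<Rightarrow> nat set \<Rightarrow> nat \<Rightarrow> nat \<Rightarrow> (nat \<Rightarrow> nat \<Rightarrow> complex) \<Rightarrow> (nat set, nat set) cmatrix" where
  "orbit_block n d x i j \<phi> = (\<lambda>y z.
     if y \<in> sphere_at n d x i \<and> z \<in> sphere_at n d x j
     then \<phi> (card ((x \<inter> y) \<inter> (x \<inter> z))) (card ((y - x) \<inter> (z - x))) else 0)"

text \<open>The matrices invariant under the permutations of \<open>{1..n}\<close> that preserve \<open>x\<close>.\<close>

definition stabilizer_invariant :: "nat \<Rightarrow> nat \<Rightarrow> nat set \<Rightarrow> (nat set, nat set) cmatrix set" where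
  "stabilizer_invariant n d x = {N \<in> cmatrices ([{1..n}]\<^bsup>d\<^esup>) ([{1..n}]\<^bsup>d\<^esup>).
     \<forall>\<pi>. \<pi> permutes {1..n} \<and> \<pi> ` x = x \<longrightarrow>
       (\<forall>y\<in>[{1..n}]\<^bsup>d\<^esup>. \<forall>z\<in>[{1..n}]\<^bsup>d\<^esup>. N (\<pi> ` y) (\<pi> ` z) = N y z)}"

lemma cmatrices_iff: "N \<in> cmatrices R C \<longleftrightarrow> (\<forall>r c. r \<notin> R \<or> c \<notin> C \<longrightarrow> N r c = 0)"
  by (auto simp: cmatrices_def)

lemma image_permutes_in_nsets_iff:
  assumes "\<pi> permutes V"
  shows "\<pi> ` y \<in> [V]\<^bsup>k\<^esup> \<longleftrightarrow> y \<in> [V]\<^bsup>k\<^esup>"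
proof -
  have "inj_on \<pi> y" using permutes_inj[OF assms] inj_on_subset by blast
  moreover have "\<pi> ` y \<subseteq> V \<longleftrightarrow> y \<subseteq> V" using permutes_in_image[OF assms] by blast
  ultimately show ?thesis by (auto simp: nsets_def card_image finite_image_iff)
qed

lemma matrix_subalgebra_stabilizer_invariant:
  "matrix_subalgebra ([{1..n}]\<^bsup>d\<^esup>) (stabilizer_invariant n d x)"
proof -
  let ?X = "[{1..n}]\<^bsup>d\<^esup>"
  have "cmat_mult ?X A B \<in> stabilizer_invariant n d x"
    if AB: "A \<in> stabilizer_invariant n d x" "B \<in> stabilizer_invariant n d x" for A B
  proof -
    have "cmat_mult ?X A B (\<pi> ` y) (\<pi> ` z) = cmat_mult ?X A B y z"
      if \<pi>: "\<pi> permutes {1..n}" "\<pi> ` x = x" and yz: "y \<in> ?X" "z \<in> ?X" for \<pi> y z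
    proof -
      have "cmat_mult ?X A B (\<pi> ` y) (\<pi> ` z) = (\<Sum>w\<in>?X. A (\<pi> ` y) (\<pi> ` w) * B (\<pi> ` w) (\<pi> ` z))"
        unfolding cmat_mult_def
        by (rule sum.reindex_bij_betw[OF bij_betw_image_nsets[OF \<pi>(1)], symmetric])
      also have "\<dots> = cmat_mult ?X A B y z"
        unfolding cmat_mult_def using AB \<pi> yz
        by (intro sum.cong) (auto simp: stabilizer_invariant_def)
      finally show ?thesis .
    qed
    moreover have "cmat_mult ?X A B \<in> cmatrices ?X ?X"
      using AB by (auto simp: cmatrices_iff cmat_mult_def stabilizer_invariant_def)
    ultimately show ?thesis by (simp add: stabilizer_invariant_def)
  qed
  moreover have "cmat.subspace (stabilizer_invariant n d x)"
    by (rule cmat.subspaceI) (auto simp: stabilizer_invariant_def cmatrices_iff cmat_scale_def)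
  moreover have "cmat_one ?X \<in> stabilizer_invariant n d x"
  proof -
    have "\<pi> ` y = \<pi> ` z \<longleftrightarrow> y = z" if "\<pi> permutes {1..n}" for \<pi> y z
      using permutes_inj[OF that] by (simp add: inj_image_eq_iff)
    then show ?thesis
      by (auto simp: stabilizer_invariant_def cmatrices_def cmat_one_def image_permutes_in_nsets_iff)
  qed
  ultimately show ?thesis
    by (auto simp: matrix_subalgebra_def stabilizer_invariant_def)
qed

lemma terwilliger_algebra_subset_invariant:
  assumes x: "x \<in> [{1..n}]\<^bsup>d\<^esup>"
  shows "terwilliger_algebra n d x \<subseteq> stabilizer_invariant n d x"
  unfolding terwilliger_algebra_def
proof (rule hull_minimal[where S = "matrix_subalgebra ([{1..n}]\<^bsup>d\<^esup>)", OF _ matrix_subalgebra_stabilizer_invariant])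
  have card: "card (\<pi> ` a \<inter> \<pi> ` b) = card (a \<inter> b)" if "\<pi> permutes {1..n}" for \<pi> a b
    using permutes_inj[OF that] inj_on_subset[OF permutes_inj[OF that] subset_UNIV]
    by (simp add: card_image flip: image_Int)
  have "johnson_adj n d i \<in> stabilizer_invariant n d x" for i
    by (auto simp: stabilizer_invariant_def cmatrices_def johnson_adj_def johnson_rel_def card
        image_permutes_in_nsets_iff)
  moreover have "dual_idempotent n d x i \<in> stabilizer_invariant n d x" for i
  proof -
    have "card (x \<inter> \<pi> ` y) = card (x \<inter> y)" if "\<pi> permutes {1..n}" "\<pi> ` x = x" for \<pi> y
      using card[OF that(1), of x y] that(2) by simp
    moreover have "\<pi> ` y = \<pi> ` z \<longleftrightarrow> y = z" if "\<pi> permutes {1..n}" for \<pi> y z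
      using permutes_inj[OF that] by (simp add: inj_image_eq_iff)
    ultimately show ?thesis
      by (auto simp: stabilizer_invariant_def cmatrices_def dual_idempotent_def johnson_rel_def
          image_permutes_in_nsets_iff)
  qed
  ultimately show "johnson_adj n d ` {0..d} \<union> dual_idempotent n d x ` {0..d} \<subseteq> stabilizer_invariant n d x"
    by blast
qed


\<comment> \<open>Keeps the simplifier from rewriting \<open>{1..n}\<close> to \<open>{Suc 0..n}\<close>.\<close>
declare One_nat_def [simp del]

text \<open>A base vertex of the Johnson scheme. The condition \<open>2 d < n\<close> makes every size \<open>i \<le> d\<close> occur
  among the subsets of the complement of \<open>x\<close>, and excludes \<open>n = 2 d\<close>, for which the coefficient
  \<open>n - 2 d\<close> below vanishes.\<close>

locale johnson_base_point =
  fixes n d :: nat and x :: "nat set"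
  assumes base_point: "x \<in> [{1..n}]\<^bsup>d\<^esup>" and d_pos: "0 < d" and two_d_less: "2 * d < n"
begin

abbreviation vertices :: "nat set set" where "vertices \<equiv> [{1..n}]\<^bsup>d\<^esup>"
abbreviation outside :: "nat set" where "outside \<equiv> {1..n} - x"
abbreviation sphere :: "nat \<Rightarrow> nat set set" where "sphere \<equiv> sphere_at n d x"
abbreviation orbit :: "nat \<Rightarrow> nat \<Rightarrow> (nat \<Rightarrow> nat \<Rightarrow> complex) \<Rightarrow> (nat set, nat set) cmatrix"
  where "orbit \<equiv> orbit_block n d x"

lemma base_point_simps: "x \<subseteq> {1..n}" "finite x" "card x = d"
  using base_point by (auto simp: nsets_def)

lemma card_outside: "card outside = n - d"
  using base_point_simps by (simp add: card_Diff_subset)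

lemma card_vertex_split: "finite y \<Longrightarrow> card y = card (x \<inter> y) + card (y - x)"
  using card_Int_Diff[of y x] by (simp add: Int_commute)

lemma sphere_iff:
  assumes "i \<le> d"
  shows "y \<in> sphere i \<longleftrightarrow> y \<subseteq> {1..n} \<and> x \<inter> y \<in> [x]\<^bsup>(d - i)\<^esup> \<and> y - x \<in> [outside]\<^bsup>i\<^esup>"
proof -
  have "card y = card (x \<inter> y) + card (y - x)" if "y \<subseteq> {1..n}"
    using that by (intro card_vertex_split) (auto intro: finite_subset)
  then show ?thesis
    using assms base_point_simps(2) by (auto simp: sphere_at_def nsets_def intro: finite_subset)
qed

lemma sphere_subset_vertices: "y \<in> sphere i \<Longrightarrow> y \<in> vertices"
  by (simp add: sphere_at_def)

lemma vertex_in_sphere: "y \<in> vertices \<Longrightarrow> y \<in> sphere (d - card (x \<inter> y))"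
  using card_mono[of x "x \<inter> y"] base_point_simps by (auto simp: sphere_at_def)

lemma sphere_unique: "y \<in> sphere i \<Longrightarrow> i \<le> d \<Longrightarrow> i = d - card (x \<inter> y)"
  by (auto simp: sphere_at_def)

lemma finite_sphere: "finite (sphere i)"
  by (rule finite_subset[OF _ finite_imp_finite_nsets[of "{1..n}" d]]) (auto simp: sphere_at_def)

text \<open>The splitting \<open>w \<mapsto> (x \<inter> w, w - x)\<close> identifies \<open>\<Omega>\<^sub>i\<close> with a product, so sums over it factor.\<close>

lemma sum_sphere_split:
  fixes F G :: "nat set \<Rightarrow> complex"
  assumes "i \<le> d"
  shows "(\<Sum>w\<in>sphere i. F (x \<inter> w) * G (w - x)) = (\<Sum>\<gamma>\<in>[x]\<^bsup>(d - i)\<^esup>. F \<gamma>) * (\<Sum>\<gamma>\<in>[outside]\<^bsup>i\<^esup>. G \<gamma>)"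
proof -
  have bij: "bij_betw (\<lambda>w. (x \<inter> w, w - x)) (sphere i) ([x]\<^bsup>(d - i)\<^esup> \<times> [outside]\<^bsup>i\<^esup>)"
  proof (rule bij_betw_byWitness[where f' = "\<lambda>(a, b). a \<union> b"])
    show "\<forall>w\<in>sphere i. (case (x \<inter> w, w - x) of (a, b) \<Rightarrow> a \<union> b) = w" by auto
    have id: "x \<inter> (a \<union> b) = a" "(a \<union> b) - x = b" if "a \<in> [x]\<^bsup>(d - i)\<^esup>" "b \<in> [outside]\<^bsup>i\<^esup>" for a b
      using that by (auto simp: nsets_def)
    then show "\<forall>p\<in>[x]\<^bsup>(d - i)\<^esup> \<times> [outside]\<^bsup>i\<^esup>.
        (\<lambda>w. (x \<inter> w, w - x)) (case p of (a, b) \<Rightarrow> a \<union> b) = p" by auto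
    show "(\<lambda>w. (x \<inter> w, w - x)) ` sphere i \<subseteq> [x]\<^bsup>(d - i)\<^esup> \<times> [outside]\<^bsup>i\<^esup>"
      using sphere_iff[OF assms] by auto
    have "a \<union> b \<subseteq> {1..n}" if "a \<in> [x]\<^bsup>(d - i)\<^esup>" "b \<in> [outside]\<^bsup>i\<^esup>" for a b
      using that base_point_simps(1) by (auto simp: nsets_def)
    then show "(\<lambda>(a, b). a \<union> b) ` ([x]\<^bsup>(d - i)\<^esup> \<times> [outside]\<^bsup>i\<^esup>) \<subseteq> sphere i"
      using id by (auto simp: sphere_iff[OF assms] simp del: Un_subset_iff)
  qed
  have "(\<Sum>w\<in>sphere i. F (x \<inter> w) * G (w - x)) = (\<Sum>(a, b)\<in>[x]\<^bsup>(d - i)\<^esup> \<times> [outside]\<^bsup>i\<^esup>. F a * G b)"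
    using sum.reindex_bij_betw[OF bij, of "\<lambda>(a, b). F a * G b"] by simp
  also have "\<dots> = (\<Sum>\<gamma>\<in>[x]\<^bsup>(d - i)\<^esup>. F \<gamma>) * (\<Sum>\<gamma>\<in>[outside]\<^bsup>i\<^esup>. G \<gamma>)"
    by (simp add: sum_product sum.cartesian_product)
  finally show ?thesis .
qed

lemma orbit_cong:
  assumes "i \<le> d" "j \<le> d"
    and "\<And>r s. r \<le> d - i \<Longrightarrow> r \<le> d - j \<Longrightarrow> s \<le> i \<Longrightarrow> s \<le> j \<Longrightarrow> \<phi> r s = \<psi> r s"
  shows "orbit i j \<phi> = orbit i j \<psi>"
proof (intro ext)
  fix y z
  show "orbit i j \<phi> y z = orbit i j \<psi> y z"
  proof (cases "y \<in> sphere i \<and> z \<in> sphere j")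
    case True
    then have "x \<inter> y \<in> [x]\<^bsup>(d - i)\<^esup>" "y - x \<in> [outside]\<^bsup>i\<^esup>" "x \<inter> z \<in> [x]\<^bsup>(d - j)\<^esup>" "z - x \<in> [outside]\<^bsup>j\<^esup>"
      using sphere_iff assms(1,2) by auto
    then have "\<phi> (card ((x \<inter> y) \<inter> (x \<inter> z))) (card ((y - x) \<inter> (z - x)))
        = \<psi> (card ((x \<inter> y) \<inter> (x \<inter> z))) (card ((y - x) \<inter> (z - x)))"
      by (intro assms(3) card_Int_le_nsets)
    then show ?thesis by (simp only: orbit_block_def)
  qed (auto simp: orbit_block_def)
qed

text \<open>Blocks with a product function behave like Kronecker products: the factors multiply
  separately.\<close>

lemma orbit_mult_tensor:
  assumes ijk: "i \<le> d" "j \<le> d" "k \<le> d"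
    and \<chi>\<^sub>1: "\<forall>\<alpha>\<in>[x]\<^bsup>(d - i)\<^esup>. \<forall>\<beta>\<in>[x]\<^bsup>(d - k)\<^esup>.
      (\<Sum>\<gamma>\<in>[x]\<^bsup>(d - j)\<^esup>. \<phi>\<^sub>1 (card (\<alpha> \<inter> \<gamma>)) * \<psi>\<^sub>1 (card (\<gamma> \<inter> \<beta>))) = \<chi>\<^sub>1 (card (\<alpha> \<inter> \<beta>))"
    and \<chi>\<^sub>2: "\<forall>\<alpha>\<in>[outside]\<^bsup>i\<^esup>. \<forall>\<beta>\<in>[outside]\<^bsup>k\<^esup>.
      (\<Sum>\<gamma>\<in>[outside]\<^bsup>j\<^esup>. \<phi>\<^sub>2 (card (\<alpha> \<inter> \<gamma>)) * \<psi>\<^sub>2 (card (\<gamma> \<inter> \<beta>))) = \<chi>\<^sub>2 (card (\<alpha> \<inter> \<beta>))"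
  shows "cmat_mult vertices (orbit i j (\<lambda>r s. \<phi>\<^sub>1 r * \<phi>\<^sub>2 s)) (orbit j k (\<lambda>r s. \<psi>\<^sub>1 r * \<psi>\<^sub>2 s))
    = orbit i k (\<lambda>r s. \<chi>\<^sub>1 r * \<chi>\<^sub>2 s)"
proof (intro ext)
  fix y z
  let ?A = "orbit i j (\<lambda>r s. \<phi>\<^sub>1 r * \<phi>\<^sub>2 s)" and ?B = "orbit j k (\<lambda>r s. \<psi>\<^sub>1 r * \<psi>\<^sub>2 s)"
  show "cmat_mult vertices ?A ?B y z = orbit i k (\<lambda>r s. \<chi>\<^sub>1 r * \<chi>\<^sub>2 s) y z"
  proof (cases "y \<in> sphere i \<and> z \<in> sphere k")
    case True
    have "cmat_mult vertices ?A ?B y z = (\<Sum>w\<in>sphere j. ?A y w * ?B w z)"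
      unfolding cmat_mult_def
      by (intro sum.mono_neutral_right finite_imp_finite_nsets)
        (auto simp: orbit_block_def dest: sphere_subset_vertices)
    also have "\<dots> = (\<Sum>w\<in>sphere j.
        (\<phi>\<^sub>1 (card ((x \<inter> y) \<inter> (x \<inter> w))) * \<psi>\<^sub>1 (card ((x \<inter> w) \<inter> (x \<inter> z)))) *
        (\<phi>\<^sub>2 (card ((y - x) \<inter> (w - x))) * \<psi>\<^sub>2 (card ((w - x) \<inter> (z - x)))))"
      using True by (intro sum.cong) (auto simp: orbit_block_def)
    also have "\<dots> = (\<Sum>\<gamma>\<in>[x]\<^bsup>(d - j)\<^esup>. \<phi>\<^sub>1 (card ((x \<inter> y) \<inter> \<gamma>)) * \<psi>\<^sub>1 (card (\<gamma> \<inter> (x \<inter> z)))) *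
        (\<Sum>\<gamma>\<in>[outside]\<^bsup>j\<^esup>. \<phi>\<^sub>2 (card ((y - x) \<inter> \<gamma>)) * \<psi>\<^sub>2 (card (\<gamma> \<inter> (z - x))))"
      by (rule sum_sphere_split[OF ijk(2)])
    also have "\<dots> = \<chi>\<^sub>1 (card ((x \<inter> y) \<inter> (x \<inter> z))) * \<chi>\<^sub>2 (card ((y - x) \<inter> (z - x)))"
      using True \<chi>\<^sub>1 \<chi>\<^sub>2 sphere_iff ijk by simp
    finally show ?thesis using True by (simp add: orbit_block_def)
  next
    case False
    then show ?thesis by (auto simp: orbit_block_def cmat_mult_def intro!: sum.neutral)
  qed
qed

lemma orbit_add: "orbit i j (\<lambda>r s. \<phi> r s + \<psi> r s) = orbit i j \<phi> + orbit i j \<psi>"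
  by (auto simp: orbit_block_def fun_eq_iff)

lemma orbit_scale: "orbit i j (\<lambda>r s. c * \<phi> r s) = cmat_scale c (orbit i j \<phi>)"
  by (auto simp: orbit_block_def cmat_scale_def fun_eq_iff)


subsection \<open>Invariant matrices are block sums\<close>

lemma orbit_sum_entry:
  assumes "y \<in> vertices" "z \<in> vertices"
  shows "(\<Sum>i\<in>{0..d}. \<Sum>j\<in>{0..d}. orbit i j (\<Phi> i j)) y z =
    \<Phi> (d - card (x \<inter> y)) (d - card (x \<inter> z)) (card ((x \<inter> y) \<inter> (x \<inter> z))) (card ((y - x) \<inter> (z - x)))"
    (is "_ = \<Phi> ?i ?j ?r ?s")
proof -
  have y: "y \<in> sphere i \<longleftrightarrow> i = ?i" and z: "z \<in> sphere i \<longleftrightarrow> i = ?j" if "i \<in> {0..d}" for i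
    using that vertex_in_sphere[OF assms(1)] vertex_in_sphere[OF assms(2)] sphere_unique[of _ i]
    by auto
  have "orbit i j (\<Phi> i j) y z = (if i = ?i then if j = ?j then \<Phi> ?i ?j ?r ?s else 0 else 0)"
    if "i \<in> {0..d}" "j \<in> {0..d}" for i j
    unfolding orbit_block_def y[OF that(1)] z[OF that(2)] by simp
  then have "(\<Sum>i\<in>{0..d}. \<Sum>j\<in>{0..d}. orbit i j (\<Phi> i j)) y z
      = (\<Sum>i\<in>{0..d}. \<Sum>j\<in>{0..d}. if i = ?i then if j = ?j then \<Phi> ?i ?j ?r ?s else 0 else 0)"
    unfolding sum_fun2_apply by (intro sum.cong refl)
  also have "\<dots> = (\<Sum>i\<in>{0..d}. if i = ?i then \<Phi> ?i ?j ?r ?s else 0)"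
    by (intro sum.cong refl) auto
  finally show ?thesis by simp
qed

lemma stabilizer_invariant_eq_orbit_sum:
  assumes N: "N \<in> stabilizer_invariant n d x"
  obtains \<Phi> where "N = (\<Sum>i\<in>{0..d}. \<Sum>j\<in>{0..d}. orbit i j (\<Phi> i j))"
proof -
  define key where "key = (\<lambda>(y, z). (d - card (x \<inter> y), d - card (x \<inter> z),
    card ((x \<inter> y) \<inter> (x \<inter> z)), card ((y - x) \<inter> (z - x))))"
  have eq: "N y z = N y' z'" if v: "y \<in> vertices" "z \<in> vertices" "y' \<in> vertices" "z' \<in> vertices"
    and k: "key (y, z) = key (y', z')" for y z y' z'
  proof -
    have le: "card (x \<inter> w) \<le> d" for w
      using card_mono[of x "x \<inter> w"] base_point_simps by auto
    have fin: "finite y" "finite z" "finite y'" "finite z'" using v by (auto simp: nsets_def)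
    have k': "card (x \<inter> y) = card (x \<inter> y')" "card (x \<inter> z) = card (x \<inter> z')"
      "card ((x \<inter> y) \<inter> (x \<inter> z)) = card ((x \<inter> y') \<inter> (x \<inter> z'))"
      "card ((y - x) \<inter> (z - x)) = card ((y' - x) \<inter> (z' - x))"
      using k le[of y] le[of z] le[of y'] le[of z'] unfolding key_def by auto
    have int: "(x \<inter> a) \<inter> (x \<inter> b) = x \<inter> (a \<inter> b)" "(a - x) \<inter> (b - x) = (a \<inter> b) - x" for a b
      by auto
    have "card (y \<inter> z) = card (y' \<inter> z')"
      using k'(3,4) card_vertex_split[of "y \<inter> z"] card_vertex_split[of "y' \<inter> z'"] fin
      unfolding int by simp
    then obtain \<pi> where "\<pi> permutes {1..n}" "\<pi> ` x = x" "\<pi> ` y = y'" "\<pi> ` z = z'"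
      using exists_permutation_sets[of "{1..n}" x y z y' z'] v k' base_point_simps(1)
      unfolding int by (auto simp: nsets_def)
    then show ?thesis using N v by (auto simp: stabilizer_invariant_def)
  qed
  have "\<exists>\<Psi>. \<forall>p. p \<in> vertices \<times> vertices \<longrightarrow> (case p of (y, z) \<Rightarrow> N y z) = \<Psi> (key p)"
    by (rule function_factors_left_gen[THEN iffD1]) (use eq in auto)
  then obtain \<Psi> where \<Psi>: "\<And>y z. y \<in> vertices \<Longrightarrow> z \<in> vertices \<Longrightarrow> N y z = \<Psi> (key (y, z))"
    by fast
  have "N y z = (\<Sum>i\<in>{0..d}. \<Sum>j\<in>{0..d}. orbit i j (\<lambda>r s. \<Psi> (i, j, r, s))) y z" for y z
  proof (cases "y \<in> vertices \<and> z \<in> vertices")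
    case True
    then have yz: "y \<in> vertices" "z \<in> vertices" by auto
    show ?thesis unfolding orbit_sum_entry[OF yz] using \<Psi>[OF yz] by (simp add: key_def)
  next
    case False
    then have "N y z = 0" using N by (auto simp: stabilizer_invariant_def cmatrices_iff)
    moreover have "orbit i j \<phi> y z = 0" for i j \<phi>
      using False by (auto simp: orbit_block_def dest: sphere_subset_vertices)
    ultimately show ?thesis by (simp add: sum_fun2_apply)
  qed
  then show thesis by (intro that[of "\<lambda>i j r s. \<Psi> (i, j, r, s)"]) (simp add: fun_eq_iff)
qed

lemma block_embedding_pair_kernel:
  assumes f: "bij_betw f x {1..d}" and g: "bij_betw g outside {1..n - d}" and ij: "i \<le> d" "j \<le> d"
  shows "block_embedding n d x f g i j (pair_kernel n d i j \<phi>) = orbit i j \<phi>"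
proof -
  have inj: "inj_on f x" "inj_on g outside" using f g by (auto simp: bij_betw_def)
  have image: "h ` a \<in> [W]\<^bsup>k\<^esup>" if "bij_betw h V W" "a \<in> [V]\<^bsup>k\<^esup>" for h a k and V W :: "nat set"
    using that by (auto simp: bij_betw_def nsets_def card_image inj_on_subset)
  have "block_embedding n d x f g i j (pair_kernel n d i j \<phi>) y z = orbit i j \<phi> y z"
    if y: "y \<in> sphere i" and z: "z \<in> sphere j" for y z
  proof -
    have y': "x \<inter> y \<in> [x]\<^bsup>(d - i)\<^esup>" "y - x \<in> [outside]\<^bsup>i\<^esup>"
      and z': "x \<inter> z \<in> [x]\<^bsup>(d - j)\<^esup>" "z - x \<in> [outside]\<^bsup>j\<^esup>"
      using y z ij by (auto simp: sphere_iff)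
    have "card (f ` (x \<inter> y) \<inter> f ` (x \<inter> z)) = card ((x \<inter> y) \<inter> (x \<inter> z))"
      using inj_on_subset[OF inj(1), of "(x \<inter> y) \<inter> (x \<inter> z)"]
      by (subst inj_on_image_Int[OF inj(1), symmetric]) (auto intro: card_image)
    moreover have "card (g ` (y - x) \<inter> g ` (z - x)) = card ((y - x) \<inter> (z - x))"
    proof -
      have "y - x \<subseteq> outside" "z - x \<subseteq> outside" using y' z' by (auto simp: nsets_def)
      then show ?thesis
        using inj_on_subset[OF inj(2), of "(y - x) \<inter> (z - x)"]
        by (subst inj_on_image_Int[OF inj(2), symmetric]) (auto intro: card_image)
    qed
    ultimately show ?thesis
      using y z image[OF f] image[OF g] y' z'
      by (simp add: block_embedding_def orbit_block_def split_at_def pair_kernel_def Int_commute[of _ x])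
  qed
  then show ?thesis by (auto simp: block_embedding_def orbit_block_def fun_eq_iff)
qed

lemma block_sum_eq_orbit_sums:
  assumes f: "bij_betw f x {1..d}" and g: "bij_betw g outside {1..n - d}"
  shows "block_sum n d x f g = {\<Sum>i\<in>{0..d}. \<Sum>j\<in>{0..d}. orbit i j (\<Phi> i j) | \<Phi>. True}"
proof (intro equalityI subsetI)
  fix N assume "N \<in> block_sum n d x f g"
  then obtain Y where N: "N = (\<Sum>i\<in>{0..d}. \<Sum>j\<in>{0..d}. block_embedding n d x f g i j (Y i j))"
    and Y: "\<forall>i\<in>{0..d}. \<forall>j\<in>{0..d}. Y i j \<in> block_space n d i j"
    by (auto simp: block_sum_def)
  have "\<forall>i j. \<exists>\<phi>. i \<le> d \<longrightarrow> j \<le> d \<longrightarrow> Y i j = pair_kernel n d i j \<phi>"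
    using Y block_space_eq two_d_less by fastforce
  then obtain \<Phi> where "\<And>i j. i \<le> d \<Longrightarrow> j \<le> d \<Longrightarrow> Y i j = pair_kernel n d i j (\<Phi> i j)"
    by metis
  then have "N = (\<Sum>i\<in>{0..d}. \<Sum>j\<in>{0..d}. orbit i j (\<Phi> i j))"
    unfolding N by (intro sum.cong refl) (simp add: block_embedding_pair_kernel[OF f g])
  then show "N \<in> {\<Sum>i\<in>{0..d}. \<Sum>j\<in>{0..d}. orbit i j (\<Phi> i j) | \<Phi>. True}" by blast
next
  fix N assume "N \<in> {\<Sum>i\<in>{0..d}. \<Sum>j\<in>{0..d}. orbit i j (\<Phi> i j) | \<Phi>. True}"
  then obtain \<Phi> where "N = (\<Sum>i\<in>{0..d}. \<Sum>j\<in>{0..d}. orbit i j (\<Phi> i j))" by blast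
  also have "\<dots> = (\<Sum>i\<in>{0..d}. \<Sum>j\<in>{0..d}.
      block_embedding n d x f g i j (pair_kernel n d i j (\<Phi> i j)))"
    by (intro sum.cong refl) (simp add: block_embedding_pair_kernel[OF f g])
  also have "\<dots> \<in> block_sum n d x f g"
    unfolding block_sum_def using block_space_eq two_d_less
    by (intro CollectI exI[of _ "\<lambda>i j. pair_kernel n d i j (\<Phi> i j)"] conjI refl) auto
  finally show "N \<in> block_sum n d x f g" .
qed

end


section \<open>The Terwilliger algebra contains all block sums\<close>

text \<open>An arbitrary algebra containing the generators of the Terwilliger algebra.\<close>

locale johnson_subalgebra = johnson_base_point +
  fixes T :: "(nat set, nat set) cmatrix set"
  assumes subalgebra: "matrix_subalgebra vertices T"
    and adj_mem: "\<And>k. k \<le> d \<Longrightarrow> johnson_adj n d k \<in> T"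
    and dual_mem: "\<And>k. k \<le> d \<Longrightarrow> dual_idempotent n d x k \<in> T"
begin

lemma mult_mem: "A \<in> T \<Longrightarrow> B \<in> T \<Longrightarrow> cmat_mult vertices A B \<in> T"
  using subalgebra by (auto simp: matrix_subalgebra_def)

lemma subspace_T: "cmat.subspace T"
  using subalgebra by (auto simp: matrix_subalgebra_def)

lemma orbit_add_mem: "orbit i j \<phi> \<in> T \<Longrightarrow> orbit i j \<psi> \<in> T \<Longrightarrow> orbit i j (\<lambda>r s. \<phi> r s + \<psi> r s) \<in> T"
  unfolding orbit_add by (rule cmat.subspace_add[OF subspace_T])

lemma orbit_scale_mem: "orbit i j \<phi> \<in> T \<Longrightarrow> orbit i j (\<lambda>r s. c * \<phi> r s) \<in> T"
  unfolding orbit_scale by (rule cmat.subspace_scale[OF subspace_T])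

lemma orbit_zero_mem: "orbit i j (\<lambda>r s. 0) \<in> T"
proof -
  have "orbit i j (\<lambda>r s. 0) = 0" by (auto simp: orbit_block_def fun_eq_iff)
  then show ?thesis using cmat.subspace_0[OF subspace_T] by simp
qed

lemma orbit_mult_tensor_mem:
  assumes "i \<le> d" "j \<le> d" "k \<le> d"
    and "orbit i j (\<lambda>r s. \<phi>\<^sub>1 r * \<phi>\<^sub>2 s) \<in> T" "orbit j k (\<lambda>r s. \<psi>\<^sub>1 r * \<psi>\<^sub>2 s) \<in> T"
    and "\<And>\<alpha> \<beta>. \<alpha> \<in> [x]\<^bsup>(d - i)\<^esup> \<Longrightarrow> \<beta> \<in> [x]\<^bsup>(d - k)\<^esup> \<Longrightarrow>
      (\<Sum>\<gamma>\<in>[x]\<^bsup>(d - j)\<^esup>. \<phi>\<^sub>1 (card (\<alpha> \<inter> \<gamma>)) * \<psi>\<^sub>1 (card (\<gamma> \<inter> \<beta>))) = \<chi>\<^sub>1 (card (\<alpha> \<inter> \<beta>))"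
    and "\<And>\<alpha> \<beta>. \<alpha> \<in> [outside]\<^bsup>i\<^esup> \<Longrightarrow> \<beta> \<in> [outside]\<^bsup>k\<^esup> \<Longrightarrow>
      (\<Sum>\<gamma>\<in>[outside]\<^bsup>j\<^esup>. \<phi>\<^sub>2 (card (\<alpha> \<inter> \<gamma>)) * \<psi>\<^sub>2 (card (\<gamma> \<inter> \<beta>))) = \<chi>\<^sub>2 (card (\<alpha> \<inter> \<beta>))"
  shows "orbit i k (\<lambda>r s. \<chi>\<^sub>1 r * \<chi>\<^sub>2 s) \<in> T"
  using mult_mem[OF assms(4,5)] orbit_mult_tensor[OF assms(1-3), of \<phi>\<^sub>1 \<psi>\<^sub>1 \<chi>\<^sub>1 \<phi>\<^sub>2 \<psi>\<^sub>2 \<chi>\<^sub>2] assms(6,7)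
  by simp

text \<open>The blocks of the adjacency matrices: \<open>r + s\<close> is the size of \<open>y \<inter> z\<close>.\<close>

lemma orbit_total_mem:
  assumes "i \<le> d" "j \<le> d" "t \<le> d"
  shows "orbit i j (\<lambda>r s. of_bool (r + s = t)) \<in> T"
proof -
  let ?E = "dual_idempotent n d x"
  have E: "?E k y z = of_bool (y = z \<and> y \<in> sphere k)" for k y z
    using base_point by (auto simp: dual_idempotent_def johnson_rel_def sphere_at_def)
  have fin: "finite vertices" by (rule finite_imp_finite_nsets) simp
  have left: "cmat_mult vertices (?E i) A y z = (if y \<in> sphere i then A y z else 0)" for A y z
  proof -
    have "cmat_mult vertices (?E i) A y z = (\<Sum>w\<in>vertices. if w = y then of_bool (y \<in> sphere i) * A y z else 0)"
      unfolding cmat_mult_def E by (intro sum.cong) auto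
    then show ?thesis using fin by (auto dest: sphere_subset_vertices)
  qed
  have right: "cmat_mult vertices A (?E j) y z = (if z \<in> sphere j then A y z else 0)" for A y z
  proof -
    have "cmat_mult vertices A (?E j) y z = (\<Sum>w\<in>vertices. if w = z then A y z * of_bool (z \<in> sphere j) else 0)"
      unfolding cmat_mult_def E by (intro sum.cong) auto
    then show ?thesis using fin by (auto dest: sphere_subset_vertices)
  qed
  have "orbit i j (\<lambda>r s. of_bool (r + s = t)) y z
      = cmat_mult vertices (?E i) (cmat_mult vertices (johnson_adj n d (d - t)) (?E j)) y z" for y z
  proof (cases "y \<in> sphere i \<and> z \<in> sphere j")
    case True
    then have v: "y \<in> vertices" "z \<in> vertices" by (auto dest: sphere_subset_vertices)
    then have "finite (y \<inter> z)" by (auto simp: nsets_def)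
    moreover have "(x \<inter> y) \<inter> (x \<inter> z) = x \<inter> (y \<inter> z)" "(y - x) \<inter> (z - x) = (y \<inter> z) - x" by auto
    ultimately have "card (y \<inter> z) = card ((x \<inter> y) \<inter> (x \<inter> z)) + card ((y - x) \<inter> (z - x))"
      using card_vertex_split[of "y \<inter> z"] by simp
    then show ?thesis
      using True v assms(3) by (auto simp: orbit_block_def left right johnson_adj_def johnson_rel_def)
  qed (auto simp: orbit_block_def left right)
  then have "orbit i j (\<lambda>r s. of_bool (r + s = t))
      = cmat_mult vertices (?E i) (cmat_mult vertices (johnson_adj n d (d - t)) (?E j))"
    by (simp add: fun_eq_iff)
  also have "\<dots> \<in> T" using assms by (intro mult_mem dual_mem adj_mem) auto
  finally show ?thesis .
qed

text \<open>The sum \<open>r + s\<close> is maximal only when both \<open>r\<close> and \<open>s\<close> are, so the block of one adjacency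
  matrix is the Kronecker product of the two inclusion matrices.\<close>

lemma orbit_inclusion_mem:
  assumes ij: "i \<le> d" "j \<le> d"
  shows "orbit i j (\<lambda>r s. of_bool (r = min (d - i) (d - j)) * of_bool (s = min i j)) \<in> T"
proof -
  have "orbit i j (\<lambda>r s. of_bool (r = min (d - i) (d - j)) * of_bool (s = min i j))
      = orbit i j (\<lambda>r s. of_bool (r + s = min (d - i) (d - j) + min i j))"
    by (rule orbit_cong[OF ij]) auto
  also have "\<dots> \<in> T" using ij by (intro orbit_total_mem) auto
  finally show ?thesis .
qed

text \<open>The products of the inclusion matrices between the blocks \<open>i\<close> and \<open>i + 1\<close>, and between the
  blocks \<open>i\<close> and \<open>i - 1\<close>. Each is a Kronecker product of two combinations of the identity and the
  distance-one matrix. If the neighbouring block does not exist, the function vanishes on the values that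
  occur.\<close>

lemma orbit_up_down_mem:
  assumes i: "i \<le> d"
  shows "orbit i i (\<lambda>r s. (if r = d - i then of_nat (d - i) else of_bool (Suc r = d - i)) *
    (if s = i then of_nat (n - d - i) else of_bool (Suc s = i))) \<in> T"
proof (cases "i = d")
  case True
  have "orbit i i (\<lambda>r s. (if r = d - i then of_nat (d - i) else of_bool (Suc r = d - i)) *
    (if s = i then of_nat (n - d - i) else of_bool (Suc s = i))) = orbit i i (\<lambda>r s. 0)"
    using True by (intro orbit_cong) auto
  then show ?thesis using orbit_zero_mem by simp
next
  case False
  define m where "m = d - Suc i"
  have m: "d - i = Suc m" "d - Suc i = m" and si: "Suc i \<le> d" using False i by (auto simp: m_def)
  show ?thesis
  proof (rule orbit_mult_tensor_mem[OF i si i])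
    show "orbit i (Suc i) (\<lambda>r s. of_bool (r = m) * of_bool (s = i)) \<in> T"
      using orbit_inclusion_mem[OF i si] m by simp
    show "orbit (Suc i) i (\<lambda>r s. of_bool (r = m) * of_bool (s = i)) \<in> T"
      using orbit_inclusion_mem[OF si i] m by simp
    show "(\<Sum>\<gamma>\<in>[x]\<^bsup>(d - Suc i)\<^esup>. of_bool (card (\<alpha> \<inter> \<gamma>) = m) * of_bool (card (\<gamma> \<inter> \<beta>) = m)) =
        (if card (\<alpha> \<inter> \<beta>) = d - i then of_nat (d - i) else of_bool (Suc (card (\<alpha> \<inter> \<beta>)) = d - i) :: complex)"
      if "\<alpha> \<in> [x]\<^bsup>(d - i)\<^esup>" "\<beta> \<in> [x]\<^bsup>(d - i)\<^esup>" for \<alpha> \<beta>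
      using sum_common_subsets[of x \<alpha> m \<beta>] that base_point_simps(2) unfolding m by simp
    show "(\<Sum>\<gamma>\<in>[outside]\<^bsup>Suc i\<^esup>. of_bool (card (\<alpha> \<inter> \<gamma>) = i) * of_bool (card (\<gamma> \<inter> \<beta>) = i)) =
        (if card (\<alpha> \<inter> \<beta>) = i then of_nat (n - d - i) else of_bool (Suc (card (\<alpha> \<inter> \<beta>)) = i) :: complex)"
      if "\<alpha> \<in> [outside]\<^bsup>i\<^esup>" "\<beta> \<in> [outside]\<^bsup>i\<^esup>" for \<alpha> \<beta>
      using sum_common_supersets[of outside \<alpha> i \<beta>] that unfolding card_outside by simp
  qed
qed

lemma orbit_down_up_mem:
  assumes i: "i \<le> d"
  shows "orbit i i (\<lambda>r s. (if r = d - i then of_nat i else of_bool (Suc r = d - i)) *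
    (if s = i then of_nat i else of_bool (Suc s = i))) \<in> T"
proof (cases i)
  case 0
  have "orbit i i (\<lambda>r s. (if r = d - i then of_nat i else of_bool (Suc r = d - i)) *
    (if s = i then of_nat i else of_bool (Suc s = i))) = orbit i i (\<lambda>r s. 0)"
    using 0 by (intro orbit_cong) auto
  then show ?thesis using orbit_zero_mem by simp
next
  case (Suc k)
  have k: "k \<le> d" and dk: "d - k = Suc (d - i)" and di: "card x - (d - i) = i"
    using Suc i base_point_simps(3) by auto
  show ?thesis
  proof (rule orbit_mult_tensor_mem[OF i k i])
    show "orbit i k (\<lambda>r s. of_bool (r = d - i) * of_bool (s = k)) \<in> T"
      using orbit_inclusion_mem[OF i k] Suc dk by simp
    show "orbit k i (\<lambda>r s. of_bool (r = d - i) * of_bool (s = k)) \<in> T"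
      using orbit_inclusion_mem[OF k i] Suc dk by simp
    show "(\<Sum>\<gamma>\<in>[x]\<^bsup>(d - k)\<^esup>. of_bool (card (\<alpha> \<inter> \<gamma>) = d - i) * of_bool (card (\<gamma> \<inter> \<beta>) = d - i)) =
        (if card (\<alpha> \<inter> \<beta>) = d - i then of_nat i else of_bool (Suc (card (\<alpha> \<inter> \<beta>)) = d - i) :: complex)"
      if "\<alpha> \<in> [x]\<^bsup>(d - i)\<^esup>" "\<beta> \<in> [x]\<^bsup>(d - i)\<^esup>" for \<alpha> \<beta>
      using sum_common_supersets[of x \<alpha> "d - i" \<beta>] that base_point_simps(2) unfolding dk di by simp
    show "(\<Sum>\<gamma>\<in>[outside]\<^bsup>k\<^esup>. of_bool (card (\<alpha> \<inter> \<gamma>) = k) * of_bool (card (\<gamma> \<inter> \<beta>) = k)) =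
        (if card (\<alpha> \<inter> \<beta>) = i then of_nat i else of_bool (Suc (card (\<alpha> \<inter> \<beta>)) = i) :: complex)"
      if "\<alpha> \<in> [outside]\<^bsup>i\<^esup>" "\<beta> \<in> [outside]\<^bsup>i\<^esup>" for \<alpha> \<beta>
      using sum_common_subsets[of outside \<alpha> k \<beta>] that unfolding Suc by simp
  qed
qed

text \<open>Here \<open>n \<noteq> 2 d\<close> enters. With \<open>A\<close> and \<open>A'\<close> the distance-one matrices of the two factors, the
  difference \<open>U - V\<close> of the two products above is a combination
  \<open>const I + (n - d - 2 i) A \<otimes> I + (d - 2 i) I \<otimes> A'\<close>, the terms \<open>A \<otimes> A'\<close> cancelling. The block
  \<open>S\<close> of the adjacency matrix is \<open>A \<otimes> I + I \<otimes> A'\<close>. Eliminating \<open>I \<otimes> A'\<close> leaves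
  \<open>(n - 2 d) A \<otimes> I\<close> up to a multiple of the identity.\<close>

lemma orbit_left_adjacency_mem:
  assumes i: "i \<le> d"
  shows "orbit i i (\<lambda>r s. of_bool (Suc r = d - i) * of_bool (s = i)) \<in> T" (is "orbit i i ?A \<in> T")
proof -
  define a b c :: complex where "a = of_nat d" and "b = of_nat n" and "c = of_nat i"
  have ab: "b - 2 * a \<noteq> 0"
  proof -
    have "b - 2 * a = of_nat (n - 2 * d)" using two_d_less by (simp add: a_def b_def of_nat_diff)
    moreover have "of_nat (n - 2 * d) \<noteq> (0 :: complex)"
      using two_d_less unfolding of_nat_eq_0_iff by simp
    ultimately show ?thesis by (simp only: not_False_eq_True)
  qed
  have nats: "of_nat (d - i) = a - c" "of_nat (n - d - i) = b - a - c" "of_nat i = c"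
    using i two_d_less by (simp_all add: a_def b_def c_def of_nat_diff)
  define U V where "U = (\<lambda>r s. (if r = d - i then a - c else of_bool (Suc r = d - i)) *
      (if s = i then b - a - c else of_bool (Suc s = i)))"
    and "V = (\<lambda>r s. (if r = d - i then c else of_bool (Suc r = d - i)) *
      (if s = i then c else of_bool (Suc s = i)))"
  define S I :: "nat \<Rightarrow> nat \<Rightarrow> complex" where "S = (\<lambda>r s. of_bool (r + s = d - 1))" and "I = (\<lambda>r s. of_bool (r + s = d))"
  let ?W = "\<lambda>r s. 1 / (b - 2 * a) * (U r s + ((- 1) * V r s + ((2 * c - a) * S r s +
      (c * c - (a - c) * (b - a - c)) * I r s)))"
  have "orbit i i U \<in> T" "orbit i i V \<in> T"
    using orbit_up_down_mem[OF i] orbit_down_up_mem[OF i] by (simp_all only: U_def V_def nats)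
  moreover have "orbit i i S \<in> T" "orbit i i I \<in> T"
    using i by (auto simp: S_def I_def intro: orbit_total_mem)
  ultimately have "orbit i i ?W \<in> T"
    by (intro orbit_scale_mem orbit_add_mem)
  moreover have "orbit i i ?W = orbit i i ?A"
  proof (rule orbit_cong[OF i i])
    fix r s assume rs: "r \<le> d - i" "s \<le> i"
    have S: "S r s = of_bool (r = d - i \<and> Suc s = i \<or> Suc r = d - i \<and> s = i)"
      and I: "I r s = of_bool (r = d - i \<and> s = i)"
      using rs i d_pos by (auto simp: S_def I_def)
    show "?W r s = ?A r s"
      unfolding S I U_def V_def using ab by (auto simp: field_simps)
  qed
  ultimately show ?thesis by simp
qed

lemma orbit_right_adjacency_mem:
  assumes i: "i \<le> d"
  shows "orbit i i (\<lambda>r s. of_bool (r = d - i) * of_bool (Suc s = i)) \<in> T"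
proof -
  have "orbit i i (\<lambda>r s. of_bool (r + s = d - 1) + (- 1) * (of_bool (Suc r = d - i) * of_bool (s = i))) \<in> T"
    using i by (intro orbit_add_mem orbit_scale_mem orbit_total_mem orbit_left_adjacency_mem) auto
  moreover have "orbit i i (\<lambda>r s. of_bool (r + s = d - 1) + (- 1) * (of_bool (Suc r = d - i) * of_bool (s = i)))
      = orbit i i (\<lambda>r s. of_bool (r = d - i) * of_bool (Suc s = i))"
    using i d_pos by (intro orbit_cong) (auto simp: of_bool_def)
  ultimately show ?thesis by simp
qed

lemma orbit_identity_mem:
  assumes "i \<le> d"
  shows "orbit i i (\<lambda>r s. of_bool (r = d - i) * of_bool (s = i)) \<in> T"
  using orbit_inclusion_mem[OF assms assms] by simp

lemma orbit_left_mem: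
  assumes i: "i \<le> d"
  shows "orbit i i (\<lambda>r s. \<phi> r * of_bool (s = i)) \<in> T"
proof -
  have "\<phi> \<in> {\<phi>. orbit i i (\<lambda>r s. \<phi> r * of_bool (s = i)) \<in> T}"
  proof (rule johnson_generated_by_adjacency[OF base_point_simps(2), where m = "d - i"], goal_cases)
    case (1 \<phi> \<psi>)
    then show ?case
      using orbit_add_mem[of i i "\<lambda>r s. \<phi> r * of_bool (s = i)" "\<lambda>r s. \<psi> r * of_bool (s = i)"]
      by (simp add: distrib_right)
  next
    case (2 c \<phi>)
    then show ?case
      using orbit_scale_mem[of i i "\<lambda>r s. \<phi> r * of_bool (s = i)" c] by (simp add: mult.assoc)
  next
    case (3 \<phi> \<psi> \<chi>)
    then show ?case
      using i by (auto intro!: orbit_mult_tensor_mem[where \<phi>\<^sub>1 = \<phi> and \<psi>\<^sub>1 = \<psi> and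
            \<phi>\<^sub>2 = "\<lambda>s. of_bool (s = i)" and \<psi>\<^sub>2 = "\<lambda>s. of_bool (s = i)" and j = i] sum_identity_left)
  next
    case 4
    then show ?case using orbit_identity_mem[OF i] by simp
  next
    case 5
    then show ?case using orbit_left_adjacency_mem[OF i] by simp
  qed
  then show ?thesis by simp
qed

lemma orbit_right_mem:
  assumes i: "i \<le> d"
  shows "orbit i i (\<lambda>r s. of_bool (r = d - i) * \<phi> s) \<in> T"
proof -
  have "\<phi> \<in> {\<phi>. orbit i i (\<lambda>r s. of_bool (r = d - i) * \<phi> s) \<in> T}"
  proof (rule johnson_generated_by_adjacency[of outside, where m = i], goal_cases)
    case 1
    then show ?case by simp
  next
    case (2 \<phi> \<psi>)
    then show ?case
      using orbit_add_mem[of i i "\<lambda>r s. of_bool (r = d - i) * \<phi> s" "\<lambda>r s. of_bool (r = d - i) * \<psi> s"]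
      by (simp add: distrib_left)
  next
    case (3 c \<phi>)
    then show ?case
      using orbit_scale_mem[of i i "\<lambda>r s. of_bool (r = d - i) * \<phi> s" c] by (simp add: mult.left_commute)
  next
    case (4 \<phi> \<psi> \<chi>)
    then show ?case
      using i base_point_simps(2) by (auto intro!: orbit_mult_tensor_mem[where \<phi>\<^sub>2 = \<phi> and \<psi>\<^sub>2 = \<psi> and
            \<phi>\<^sub>1 = "\<lambda>r. of_bool (r = d - i)" and \<psi>\<^sub>1 = "\<lambda>r. of_bool (r = d - i)" and j = i] sum_identity_left)
  next
    case 5
    then show ?case using orbit_identity_mem[OF i] by simp
  next
    case 6
    then show ?case using orbit_right_adjacency_mem[OF i] by simp
  qed
  then show ?thesis by simp
qed

lemma orbit_diagonal_tensor_mem: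
  assumes i: "i \<le> d"
  shows "orbit i i (\<lambda>r s. \<phi> r * \<psi> s) \<in> T"
  by (rule orbit_mult_tensor_mem[OF i i i orbit_left_mem[OF i] orbit_right_mem[OF i]])
    (auto intro: sum_identity_left sum_identity_right base_point_simps(2))

lemma orbit_tensor_mem:
  assumes i: "i \<le> d" and j: "j \<le> d"
  shows "orbit i j (\<lambda>r s. \<chi>\<^sub>1 r * \<chi>\<^sub>2 s) \<in> T"
proof -
  have sizes: "d - i \<le> card x" "d - j \<le> card x" "i \<le> card outside" "j \<le> card outside"
    unfolding card_outside base_point_simps(3) using two_d_less i j by auto
  obtain \<phi>\<^sub>1 :: "nat \<Rightarrow> complex" where \<phi>\<^sub>1: "\<forall>\<alpha>\<in>[x]\<^bsup>(d - i)\<^esup>. \<forall>\<beta>\<in>[x]\<^bsup>(d - j)\<^esup>.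
      (\<Sum>\<gamma>\<in>[x]\<^bsup>(d - i)\<^esup>. \<phi>\<^sub>1 (card (\<alpha> \<inter> \<gamma>)) * of_bool (card (\<gamma> \<inter> \<beta>) = min (d - i) (d - j)))
        = \<chi>\<^sub>1 (card (\<alpha> \<inter> \<beta>))"
    using inclusion_generates[OF base_point_simps(2) sizes(1,2), of \<chi>\<^sub>1] by blast
  obtain \<phi>\<^sub>2 :: "nat \<Rightarrow> complex" where \<phi>\<^sub>2: "\<forall>\<alpha>\<in>[outside]\<^bsup>i\<^esup>. \<forall>\<beta>\<in>[outside]\<^bsup>j\<^esup>.
      (\<Sum>\<gamma>\<in>[outside]\<^bsup>i\<^esup>. \<phi>\<^sub>2 (card (\<alpha> \<inter> \<gamma>)) * of_bool (card (\<gamma> \<inter> \<beta>) = min i j)) = \<chi>\<^sub>2 (card (\<alpha> \<inter> \<beta>))"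
    using inclusion_generates[OF _ sizes(3,4), of \<chi>\<^sub>2] by blast
  show ?thesis
    by (rule orbit_mult_tensor_mem[OF i i j orbit_diagonal_tensor_mem[OF i, of \<phi>\<^sub>1 \<phi>\<^sub>2] orbit_inclusion_mem[OF i j]])
      (use \<phi>\<^sub>1 \<phi>\<^sub>2 in blast)+
qed

lemma orbit_mem:
  assumes ij: "i \<le> d" "j \<le> d"
  shows "orbit i j \<phi> \<in> T"
proof -
  have "orbit i j \<phi> = orbit i j (\<lambda>r s. \<Sum>(a, b)\<in>{0..d} \<times> {0..d}. \<phi> a b * (of_bool (r = a) * of_bool (s = b)))"
  proof (rule orbit_cong[OF ij])
    fix r s assume "r \<le> d - i" "s \<le> i"
    then have rs: "(r, s) \<in> {0..d} \<times> {0..d}" using ij by auto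
    have "(\<Sum>(a, b)\<in>{0..d} \<times> {0..d}. \<phi> a b * (of_bool (r = a) * of_bool (s = b)))
        = (\<Sum>p\<in>{0..d} \<times> {0..d}. if p = (r, s) then \<phi> r s else 0)"
      by (intro sum.cong) auto
    also have "\<dots> = \<phi> r s" using rs by simp
    finally show "\<phi> r s = (\<Sum>(a, b)\<in>{0..d} \<times> {0..d}. \<phi> a b * (of_bool (r = a) * of_bool (s = b)))" ..
  qed
  also have "\<dots> = (\<Sum>(a, b)\<in>{0..d} \<times> {0..d}.
      orbit i j (\<lambda>r s. \<phi> a b * (of_bool (r = a) * of_bool (s = b))))"
    by (intro ext) (auto simp: sum_fun2_apply orbit_block_def split_def)
  also have "\<dots> \<in> T"
    by (intro cmat.subspace_sum[OF subspace_T]) (clarify, rule orbit_scale_mem, rule orbit_tensor_mem[OF ij])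
  finally show ?thesis .
qed

end


section \<open>The Terwilliger algebra of the Johnson scheme\<close>

theorem theorem4p1:
  fixes n d :: nat and x :: "nat set" and f g :: "nat \<Rightarrow> nat"
  assumes "0 < n" and "0 < d" and "2 * d < n" and "n < 3 * d"
    and "x \<in> [{1..n}]\<^bsup>d\<^esup>"
    and "bij_betw f x {1..d}" and "bij_betw g ({1..n} - x) {1..n - d}"
  shows "terwilliger_algebra n d x = block_sum n d x f g"
proof -
  interpret johnson_base_point n d x by unfold_locales (use assms in auto)
  have sums: "block_sum n d x f g = {\<Sum>i\<in>{0..d}. \<Sum>j\<in>{0..d}. orbit i j (\<Phi> i j) | \<Phi>. True}"
    using assms(6,7) by (rule block_sum_eq_orbit_sums)
  show ?thesis
  proof
    show "terwilliger_algebra n d x \<subseteq> block_sum n d x f g"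
    proof
      fix N assume "N \<in> terwilliger_algebra n d x"
      then have "N \<in> stabilizer_invariant n d x"
        using terwilliger_algebra_subset_invariant[OF base_point] by blast
      then obtain \<Phi> where "N = (\<Sum>i\<in>{0..d}. \<Sum>j\<in>{0..d}. orbit i j (\<Phi> i j))"
        by (rule stabilizer_invariant_eq_orbit_sum)
      then show "N \<in> block_sum n d x f g" unfolding sums by blast
    qed
    show "block_sum n d x f g \<subseteq> terwilliger_algebra n d x"
      unfolding terwilliger_algebra_def hull_def
    proof (rule Inter_greatest, clarify)
      fix T N
      assume T: "matrix_subalgebra vertices T"
        "johnson_adj n d ` {0..d} \<union> dual_idempotent n d x ` {0..d} \<subseteq> T"
        and N: "N \<in> block_sum n d x f g"
      interpret johnson_subalgebra n d x T by unfold_locales (use T in auto)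
      obtain \<Phi> where "N = (\<Sum>i\<in>{0..d}. \<Sum>j\<in>{0..d}. orbit i j (\<Phi> i j))" using N unfolding sums by blast
      also have "\<dots> \<in> T" by (intro cmat.subspace_sum[OF subspace_T] orbit_mem) auto
      finally show "N \<in> T" .
    qed
  qed
qed

end
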